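(* Assume all gaps of $J^0$ are open, i.e. $\lambda_j^-<\lambda_j^+$ for $j=1,\dots,q-1$, and let $(u,v)\in\mathfrak X_\nu$, $\nu\in\{2p-1,2p\}$. Let ${\rm Zeros}(S-1)$ be the set of all zeros of $S(\lambda)-1$ on the first sheet $\Lambda_1$ (counting multiplicities), where $S=f_0^-/f_0^+$. Suppose that $$\Bigl[{\rm Zeros}(S-1)\setminus\bigl(\{\mu_j\}_{j=1}^{q-1}\cap\{\lambda_k^\pm\}_{k=0}^q\bigr)\Bigr]\cap\bigl(\{\mu_j\}_{j=1}^{q-1}\cup\{\lambda_k^\pm\}_{k=0}^q\bigr)=\emptyset,$$ and that each zero of the polynomial $F=\varphi_qf_0^+f_0^-$ is simple. Then the Jost function $f_0^+$ is uniquely determined by the polynomial $F$, the set ${\rm Zeros}(S-1)$ and the constant $c_2$. (That is, for the fixed background $J^0$ and fixed $\nu$, two elements of $\mathfrak X_\nu$ satisfying these hypotheses and having the same $F$, the same ${\rm Zeros}(S-1)$ and the same $c_2$ have the same Jost function $f_0^+$.)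
   Context: Operators. $\mathbb N=\{1,2,\dots\}$, $\ell^2=\ell^2(\mathbb N)$, $q\ge2$, $p\ge1$ integers. $a_n^0>0$, $b_n^0\in\mathbb R$ are fixed $q$-periodic sequences with $\prod_{j=1}^q a_j^0=1$ and $a_0^0=a_q^0$. The operator $J^0$ on $\ell^2$ is $(J^0y)_n=a_{n-1}^0y_{n-1}+a_n^0y_{n+1}+b_n^0y_n$, $n\ge1$, with $y_0=0$. For $(u,v)=(u_n,v_n)_{n=1}^p\in\mathbb R^{2p}$ put $a_n=a_n^0+u_n$, $b_n=b_n^0+v_n$ for $1\le n\le p$, $a_n=a_n^0$, $b_n=b_n^0$ for $n\ge p+1$, $a_0=a_0^0$; $J=J^0+V$ is $(Jy)_n=a_{n-1}y_{n-1}+a_ny_{n+1}+b_ny_n$, $n\ge1$, $y_0=0$. Classes: $\mathfrak X_{2p}=\{(u,v)\in\mathbb R^{2p}: a_n^0+u_n>0\ (1\le n\le p),\ u_p\ne0\}$ and $\mathfrak X_{2p-1}=\{(u,v)\in\mathbb R^{2p}: a_n^0+u_n>0\ (1\le n\le p),\ u_p=0,\ v_p\neq0\}$. Constants: $c_1=1/\prod_{j=0}^pa_j$; $c_2=c_1u_p(a_p^0+a_p)$ if $\nu=2p$, $c_2=c_1(a_p^0)^2v_p$ if $\nu=2p-1$. Periodic objects. $\varphi_n(\lambda),\vartheta_n(\lambda)$ are the solutions of $a_{n-1}^0y_{n-1}+a_n^0y_{n+1}+b_n^0y_n=\lambda y_n$ with $\vartheta_0=\varphi_1=1$, $\vartheta_1=\varphi_0=0$;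 $\Delta=\frac12(\varphi_{q+1}+\vartheta_q)$, $\phi=\frac12(\varphi_{q+1}-\vartheta_q)$. The $2q$ zeros of $\Delta^2-1$ (with multiplicity) are $\lambda_0^+<\lambda_1^-\le\lambda_1^+<\dots<\lambda_{q-1}^-\le\lambda_{q-1}^+<\lambda_q^-$; $\lambda_0^-:=\lambda_0^+$, $\lambda_q^+:=\lambda_q^-$. Bands: $\sigma_j=[\lambda_{j-1}^+,\lambda_j^-]$, $\sigma_{\rm ac}(J^0)=\bigcup_{j=1}^q\sigma_j$. Gaps: $\gamma_j=(\lambda_j^-,\lambda_j^+)$, $1\le j\le q-1$. $\mu_j\in[\lambda_j^-,\lambda_j^+]$, $j=1,\dots,q-1$, are the zeros of $\varphi_q$ (Dirichlet eigenvalues), regarded as points of $\overline{\gamma_j^+}$ on the first sheet. Riemann surface. $\Lambda$ is the two-sheeted Riemann surface of $\sqrt{1-\Delta^2}$, obtained by gluing crosswise two copies $\Lambda_1$ (first, physical sheet, identified with $\mathbb C\setminus\sigma_{\rm ac}(J^0)$) and $\Lambda_2$ along the bands; $\gamma_j^+$ is the copy of $\gamma_j$ on $\Lambda_1$. $\Omega=\sqrt{1-\Delta^2}$ on $\Lambda$ is the branch with $\Omega<0$ on (the upper rim of) $(\lambda_{q-1}^+,\lambda_q^-)\subset\Lambda_1$, i.e. $|\Delta+i\Omega|<1$ on $\Lambda_1$. $m_\pm=\dfrac{\phi\pm i\Omega}{\varphi_q}$, meromorphic on $\Lambda$; $\psi_n^\pm=\vartheta_n+m_\pm\varphi_n$.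 Jost solutions. $f_n^\pm$ ($n\ge0$) are the solutions of $a_{n-1}y_{n-1}+a_ny_{n+1}+b_ny_n=\lambda y_n$, $n\ge1$, with $f_n^\pm=\psi_n^\pm$ for $n\ge p+1$. They are meromorphic on $\Lambda$, and the scattering matrix $S=f_0^-/f_0^+$ is regarded as a meromorphic function on $\Lambda$. $F(\lambda)=\varphi_q(\lambda)f_0^+(\lambda)f_0^-(\lambda)$, $\lambda\in\Lambda_1$, is a polynomial. *)

theory Defs
  imports "HOL-Complex_Analysis.Complex_Analysis" "HOL-Library.Multiset"
begin

section \<open>Periodic background\<close>

text \<open>
  Sequences are functions on \<^typ>\<open>nat\<close>. The coefficients \<open>b n\<close> are only used for \<open>n \<ge> 1\<close>;
  periodicity of \<open>a\<close> at \<open>n = 0\<close> is the convention \<open>a\<^sub>0 = a\<^sub>q\<close>.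
\<close>

definition periodic_jacobi :: "nat \<Rightarrow> (nat \<Rightarrow> real) \<Rightarrow> (nat \<Rightarrow> real) \<Rightarrow> bool" where
  "periodic_jacobi q a b \<longleftrightarrow>
     q \<ge> 2 \<and> (\<forall>n. a n > 0) \<and> (\<forall>n. a (n + q) = a n) \<and> (\<forall>n\<ge>1. b (n + q) = b n) \<and>
     (\<Prod>j=1..q. a j) = 1"

text \<open>The solution, as a polynomial in the spectral parameter, with initial values \<open>c0\<close>, \<open>c1\<close>.\<close>

fun jacobi_sol :: "(nat \<Rightarrow> real) \<Rightarrow> (nat \<Rightarrow> real) \<Rightarrow> real \<Rightarrow> real \<Rightarrow> nat \<Rightarrow> real poly" where
  "jacobi_sol a b c0 c1 0 = [:c0:]"
| "jacobi_sol a b c0 c1 (Suc 0) = [:c1:]"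
| "jacobi_sol a b c0 c1 (Suc (Suc n)) =
     smult (1 / a (Suc n))
       ([:- b (Suc n), 1:] * jacobi_sol a b c0 c1 (Suc n) - smult (a n) (jacobi_sol a b c0 c1 n))"

definition phi_sol :: "(nat \<Rightarrow> real) \<Rightarrow> (nat \<Rightarrow> real) \<Rightarrow> nat \<Rightarrow> real poly" where
  "phi_sol a b = jacobi_sol a b 0 1"

definition theta_sol :: "(nat \<Rightarrow> real) \<Rightarrow> (nat \<Rightarrow> real) \<Rightarrow> nat \<Rightarrow> real poly" where
  "theta_sol a b = jacobi_sol a b 1 0"

definition discriminant :: "nat \<Rightarrow> (nat \<Rightarrow> real) \<Rightarrow> (nat \<Rightarrow> real) \<Rightarrow> real poly" where
  "discriminant q a b = smult (1/2) (phi_sol a b (q + 1) + theta_sol a b q)"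

definition phi_anti :: "nat \<Rightarrow> (nat \<Rightarrow> real) \<Rightarrow> (nat \<Rightarrow> real) \<Rightarrow> real poly" where
  "phi_anti q a b = smult (1/2) (phi_sol a b (q + 1) - theta_sol a b q)"

text \<open>
  The \<open>2q\<close> zeros of \<open>\<Delta>\<^sup>2 - 1\<close> with multiplicity, all real, in increasing order are
  \<open>\<lambda>\<^sub>0\<^sup>+, \<lambda>\<^sub>1\<^sup>-, \<lambda>\<^sub>1\<^sup>+, \<dots>, \<lambda>\<^sub>q\<^sup>-\<close>, at the list positions \<open>0, \<dots>, 2q - 1\<close>.
\<close>

definition edge_list :: "nat \<Rightarrow> (nat \<Rightarrow> real) \<Rightarrow> (nat \<Rightarrow> real) \<Rightarrow> real list" where
  "edge_list q a b = sorted_list_of_multiset (proots ((discriminant q a b)\<^sup>2 - 1))"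

definition edge_plus :: "nat \<Rightarrow> (nat \<Rightarrow> real) \<Rightarrow> (nat \<Rightarrow> real) \<Rightarrow> nat \<Rightarrow> real" where
  "edge_plus q a b k = edge_list q a b ! (if k = q then 2 * q - 1 else 2 * k)"

definition edge_minus :: "nat \<Rightarrow> (nat \<Rightarrow> real) \<Rightarrow> (nat \<Rightarrow> real) \<Rightarrow> nat \<Rightarrow> real" where
  "edge_minus q a b k = edge_list q a b ! (if k = 0 then 0 else 2 * k - 1)"

definition all_gaps_open :: "nat \<Rightarrow> (nat \<Rightarrow> real) \<Rightarrow> (nat \<Rightarrow> real) \<Rightarrow> bool" where
  "all_gaps_open q a b \<longleftrightarrow> (\<forall>j\<in>{1..q-1}. edge_minus q a b j < edge_plus q a b j)"

text \<open>The Dirichlet eigenvalue \<open>\<mu>\<^sub>j\<close>, \<open>1 \<le> j \<le> q - 1\<close>: the \<open>j\<close>-th zero of \<open>\<phi>\<^sub>q\<close>.\<close>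

definition dirichlet_ev :: "nat \<Rightarrow> (nat \<Rightarrow> real) \<Rightarrow> (nat \<Rightarrow> real) \<Rightarrow> nat \<Rightarrow> real" where
  "dirichlet_ev q a b j = sorted_list_of_multiset (proots (phi_sol a b q)) ! (j - 1)"


section \<open>The Riemann surface\<close>

definition cpoly :: "real poly \<Rightarrow> complex \<Rightarrow> complex" where
  "cpoly r z = poly (map_poly complex_of_real r) z"

text \<open>
  The surface of \<open>\<surd>(1 - \<Delta>\<^sup>2)\<close> is the affine curve \<open>w\<^sup>2 = 1 - \<Delta>(z)\<^sup>2\<close>, a smooth curve when all
  gaps are open; \<open>\<Omega>\<close> is the coordinate \<open>w\<close>.
\<close>

definition surface :: "nat \<Rightarrow> (nat \<Rightarrow> real) \<Rightarrow> (nat \<Rightarrow> real) \<Rightarrow> (complex \<times> complex) set" where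
  "surface q a b = {(z, w). w\<^sup>2 = 1 - (cpoly (discriminant q a b) z)\<^sup>2}"

text \<open>
  Since \<open>(\<Delta> + i\<Omega>)(\<Delta> - i\<Omega>) = 1\<close>, and \<open>\<bar>\<Delta> + i\<Omega>\<bar> = 1\<close> exactly over the bands, the condition
  \<open>\<bar>\<Delta> + i\<Omega>\<bar> < 1\<close> selects one point over each point off the bands. The closed first
  sheet adds the rims of the bands and the band edges, that is, all points over the bands.
\<close>

definition open_sheet1 :: "nat \<Rightarrow> (nat \<Rightarrow> real) \<Rightarrow> (nat \<Rightarrow> real) \<Rightarrow> (complex \<times> complex) set" where
  "open_sheet1 q a b =
     {(z, w) \<in> surface q a b. cmod (cpoly (discriminant q a b) z + \<i> * w) < 1}"

definition closed_sheet1 :: "nat \<Rightarrow> (nat \<Rightarrow> real) \<Rightarrow> (nat \<Rightarrow> real) \<Rightarrow> (complex \<times> complex) set" where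
  "closed_sheet1 q a b =
     {(z, w) \<in> surface q a b. cmod (cpoly (discriminant q a b) z + \<i> * w) \<le> 1}"

text \<open>The points \<open>\<mu>\<^sub>j\<close> and \<open>\<lambda>\<^sub>k\<^sup>\<plusminus>\<close> of the closed first sheet.\<close>

definition dirichlet_points :: "nat \<Rightarrow> (nat \<Rightarrow> real) \<Rightarrow> (nat \<Rightarrow> real) \<Rightarrow> (complex \<times> complex) set" where
  "dirichlet_points q a b =
     {x \<in> closed_sheet1 q a b. \<exists>j\<in>{1..q-1}. fst x = of_real (dirichlet_ev q a b j)}"

definition edge_points :: "nat \<Rightarrow> (nat \<Rightarrow> real) \<Rightarrow> (nat \<Rightarrow> real) \<Rightarrow> (complex \<times> complex) set" where
  "edge_points q a b =
     {x \<in> closed_sheet1 q a b. \<exists>k\<in>{0..q}. fst x = of_real (edge_minus q a b k) \<or>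
                                          fst x = of_real (edge_plus q a b k)}"

text \<open>
  Inverse of a local coordinate of \<open>X\<close> at \<open>x\<close>: on a smooth curve, an injective holomorphic map
  from a disc into the curve is biholomorphic onto its open image.
\<close>

definition local_param ::
    "(complex \<times> complex) set \<Rightarrow> complex \<times> complex \<Rightarrow> (complex \<Rightarrow> complex \<times> complex) \<Rightarrow> bool" where
  "local_param X x g \<longleftrightarrow> g 0 = x \<and>
     (\<exists>r>0. (\<lambda>t. fst (g t)) holomorphic_on ball 0 r \<and> (\<lambda>t. snd (g t)) holomorphic_on ball 0 r \<and>
            inj_on g (ball 0 r) \<and> g ` ball 0 r \<subseteq> X)"

text \<open>
  Order of a meromorphic function at a point (positive for zeros, negative for poles). It does not
  depend on the local parameter nor on the value of the function at the point itself.
\<close>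

definition order_at ::
    "(complex \<times> complex) set \<Rightarrow> (complex \<times> complex \<Rightarrow> complex) \<Rightarrow> complex \<times> complex \<Rightarrow> int" where
  "order_at X G x = zorder (\<lambda>t. G ((SOME g. local_param X x g) t)) 0"


section \<open>The perturbed operator and its Jost solutions\<close>

text \<open>Only the values of \<open>u\<close>, \<open>v\<close> at \<open>1, \<dots>, p\<close> matter.\<close>

definition perturb :: "nat \<Rightarrow> (nat \<Rightarrow> real) \<Rightarrow> (nat \<Rightarrow> real) \<Rightarrow> nat \<Rightarrow> real" where
  "perturb p a u n = (if 1 \<le> n \<and> n \<le> p then a n + u n else a n)"

definition pert_class :: "nat \<Rightarrow> (nat \<Rightarrow> real) \<Rightarrow> nat \<Rightarrow> ((nat \<Rightarrow> real) \<times> (nat \<Rightarrow> real)) set" where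
  "pert_class p a \<nu> = {(u, v). (\<forall>n\<in>{1..p}. a n + u n > 0) \<and>
     (\<nu> = 2 * p \<and> u p \<noteq> 0 \<or> \<nu> = 2 * p - 1 \<and> u p = 0 \<and> v p \<noteq> 0)}"

definition const_c1 :: "nat \<Rightarrow> (nat \<Rightarrow> real) \<Rightarrow> (nat \<Rightarrow> real) \<Rightarrow> real" where
  "const_c1 p a u = 1 / (\<Prod>j=0..p. perturb p a u j)"

definition const_c2 ::
    "nat \<Rightarrow> (nat \<Rightarrow> real) \<Rightarrow> nat \<Rightarrow> (nat \<Rightarrow> real) \<Rightarrow> (nat \<Rightarrow> real) \<Rightarrow> real" where
  "const_c2 p a \<nu> u v =
     (if \<nu> = 2 * p then const_c1 p a u * u p * (a p + perturb p a u p)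
      else const_c1 p a u * (a p)\<^sup>2 * v p)"

text \<open>
  In the following the sign \<open>s = \<plusminus>1\<close> distinguishes the two functions \<open>m\<^sub>\<plusminus>\<close>, \<open>\<psi>\<^sup>\<plusminus>\<close>, \<open>f\<^sup>\<plusminus>\<close>. As division
  by \<open>0\<close> yields \<open>0\<close>, their values at points over the zeros of \<open>\<phi>\<^sub>q\<close> are meaningless and are never
  used: orders only depend on values in punctured neighbourhoods, and the other uses exclude
  these points.
\<close>

definition weyl_m ::
    "nat \<Rightarrow> (nat \<Rightarrow> real) \<Rightarrow> (nat \<Rightarrow> real) \<Rightarrow> complex \<Rightarrow> complex \<times> complex \<Rightarrow> complex" where
  "weyl_m q a b s x =
     (cpoly (phi_anti q a b) (fst x) + s * \<i> * snd x) / cpoly (phi_sol a b q) (fst x)"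

definition bloch ::
    "nat \<Rightarrow> (nat \<Rightarrow> real) \<Rightarrow> (nat \<Rightarrow> real) \<Rightarrow> complex \<Rightarrow> nat \<Rightarrow> complex \<times> complex \<Rightarrow> complex" where
  "bloch q a b s n x =
     cpoly (theta_sol a b n) (fst x) + weyl_m q a b s x * cpoly (phi_sol a b n) (fst x)"

definition jost ::
    "nat \<Rightarrow> (nat \<Rightarrow> real) \<Rightarrow> (nat \<Rightarrow> real) \<Rightarrow> nat \<Rightarrow> (nat \<Rightarrow> real) \<Rightarrow> (nat \<Rightarrow> real) \<Rightarrow>
     complex \<Rightarrow> nat \<Rightarrow> complex \<times> complex \<Rightarrow> complex" where
  "jost q a b p u v s n x =
     (THE y :: nat \<Rightarrow> complex.
        (\<forall>k\<ge>1. of_real (perturb p a u (k - 1)) * y (k - 1) + of_real (perturb p a u k) * y (k + 1)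
                + of_real (perturb p b v k) * y k = fst x * y k) \<and>
        (\<forall>k\<ge>p+1. y k = bloch q a b s k x)) n"

definition jost_plus ::
    "nat \<Rightarrow> (nat \<Rightarrow> real) \<Rightarrow> (nat \<Rightarrow> real) \<Rightarrow> nat \<Rightarrow> (nat \<Rightarrow> real) \<Rightarrow> (nat \<Rightarrow> real) \<Rightarrow>
     complex \<times> complex \<Rightarrow> complex" where
  "jost_plus q a b p u v = jost q a b p u v 1 0"

definition jost_minus ::
    "nat \<Rightarrow> (nat \<Rightarrow> real) \<Rightarrow> (nat \<Rightarrow> real) \<Rightarrow> nat \<Rightarrow> (nat \<Rightarrow> real) \<Rightarrow> (nat \<Rightarrow> real) \<Rightarrow>
     complex \<times> complex \<Rightarrow> complex" where
  "jost_minus q a b p u v = jost q a b p u v (- 1) 0"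

definition scattering ::
    "nat \<Rightarrow> (nat \<Rightarrow> real) \<Rightarrow> (nat \<Rightarrow> real) \<Rightarrow> nat \<Rightarrow> (nat \<Rightarrow> real) \<Rightarrow> (nat \<Rightarrow> real) \<Rightarrow>
     complex \<times> complex \<Rightarrow> complex" where
  "scattering q a b p u v x = jost_minus q a b p u v x / jost_plus q a b p u v x"

text \<open>\<open>F\<close>, as the polynomial that agrees with \<open>\<phi>\<^sub>q f\<^sub>0\<^sup>+ f\<^sub>0\<^sup>-\<close> on the first sheet.\<close>

definition F_poly ::
    "nat \<Rightarrow> (nat \<Rightarrow> real) \<Rightarrow> (nat \<Rightarrow> real) \<Rightarrow> nat \<Rightarrow> (nat \<Rightarrow> real) \<Rightarrow> (nat \<Rightarrow> real) \<Rightarrow> complex poly" where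
  "F_poly q a b p u v =
     (THE F. \<forall>x\<in>open_sheet1 q a b. cpoly (phi_sol a b q) (fst x) \<noteq> 0 \<longrightarrow>
        poly F (fst x) =
          cpoly (phi_sol a b q) (fst x) * jost_plus q a b p u v x * jost_minus q a b p u v x)"

text \<open>
  The zeros of \<open>S - 1\<close> on the first sheet, counted with multiplicity, are represented by their
  multiplicity function. The first sheet is taken with its boundary: the zeros are to be
  compared with the points \<open>\<lambda>\<^sub>k\<^sup>\<plusminus>\<close>, which lie on that boundary.
\<close>

definition zeros_mult ::
    "nat \<Rightarrow> (nat \<Rightarrow> real) \<Rightarrow> (nat \<Rightarrow> real) \<Rightarrow> nat \<Rightarrow> (nat \<Rightarrow> real) \<Rightarrow> (nat \<Rightarrow> real) \<Rightarrow>
     complex \<times> complex \<Rightarrow> nat" where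
  "zeros_mult q a b p u v x =
     (if x \<in> closed_sheet1 q a b
      then nat (order_at (surface q a b) (\<lambda>y. scattering q a b p u v y - 1) x) else 0)"

definition zeros_set ::
    "nat \<Rightarrow> (nat \<Rightarrow> real) \<Rightarrow> (nat \<Rightarrow> real) \<Rightarrow> nat \<Rightarrow> (nat \<Rightarrow> real) \<Rightarrow> (nat \<Rightarrow> real) \<Rightarrow>
     (complex \<times> complex) set" where
  "zeros_set q a b p u v = {x. zeros_mult q a b p u v x > 0}"

end

theory Submission
  imports Defs "HOL-Computational_Algebra.Fundamental_Theorem_Algebra"
begin

text \<open>
  Write \<open>Q = \<phi>\<^sub>q\<close>, \<open>H = (\<phi>\<^sub>q\<^sub>+\<^sub>1 - \<theta>\<^sub>q) / 2\<close>, \<open>D = \<Delta>\<^sup>2 - 1\<close>. A Wronskian computation gives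
  \<open>f\<^sub>0\<^sup>\<plusminus> = A + m\<^sub>\<plusminus> B = (N \<plusminus> i w B) / Q\<close> with real polynomials \<open>A\<close>, \<open>B\<close> and \<open>N = Q A + H B\<close>, where
  \<open>w\<^sup>2 = - D\<close> on the surface. Hence
  \<^item> \<open>N\<^sup>2 - D B\<^sup>2 = Q F\<close>, and
  \<^item> \<open>S - 1 = - 2 i w B / (N + i w B)\<close>,

  so that \<open>S - 1\<close> sees the zeros of \<open>B\<close>, while \<open>F\<close> links \<open>A\<close> to \<open>B\<close>. The leading coefficient of \<open>B\<close>
  is a fixed multiple of \<open>c\<^sub>2\<close>. The theorem says that \<open>(A, B)\<close> is determined by these data.

  Zeros of \<open>B\<close>. As \<open>F\<close> has simple zeros, \<open>A\<close> and \<open>B\<close> have no common zero, and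
  \<open>(N + i w B) (N - i w B) = Q F\<close> then fixes the order of the denominator of \<open>S - 1\<close> wherever \<open>B\<close>
  vanishes (\<open>zorder_numerator_at_zero_of_B\<close>). Let \<open>z\<close> be a zero of \<open>B\<close> of order \<open>k\<close>.
  \<^item> If \<open>z\<close> is neither a band edge nor a Dirichlet eigenvalue, \<open>S - 1\<close> has order \<open>k\<close> over \<open>z\<close>.
  \<^item> If \<open>z\<close> is both, the order is \<open>2 k - 1\<close>, as \<open>w\<close> is a local coordinate there.
  \<^item> If \<open>z\<close> is a Dirichlet eigenvalue in an open gap, the order is \<open>k - 1\<close>.
  \<^item> If \<open>z\<close> is any other band edge, the order is \<open>2 k + 1\<close>.

  In the first two cases \<open>k\<close> can be read off. In the third case the assumption that \<open>S - 1\<close> has no zero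
  there leaves the alternative \<open>k = 0\<close> or \<open>k = 1\<close>. In the last case it forces \<open>k = 0\<close> and moreover
  \<open>N(z) = 0\<close>, because the factor \<open>w\<close> alone would make \<open>S - 1\<close> vanish.

  Removing the ambiguity. For two perturbations with the same data let \<open>P\<^sub>i\<close> be the monic polynomial
  whose simple zeros are the zeros \<open>z\<close> of \<open>Q\<close> with \<open>D(z) = 0\<close> or \<open>B\<^sub>i(z) = 0\<close>. Then
  \<open>B\<^sub>1 P\<^sub>2 = B\<^sub>2 P\<^sub>1\<close>. At a band edge that is not a Dirichlet eigenvalue, \<open>N\<^sub>1\<close> and \<open>N\<^sub>2\<close> vanish, so that
  \<open>D (B\<^sub>1\<^sup>2 - B\<^sub>2\<^sup>2) = N\<^sub>1\<^sup>2 - N\<^sub>2\<^sup>2\<close> has a double zero; as \<open>D\<close> has only a simple one,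
  \<open>B\<^sub>1\<^sup>2 = B\<^sub>2\<^sup>2\<close> and therefore \<open>P\<^sub>1\<^sup>2 = P\<^sub>2\<^sup>2\<close> there. At the remaining band edges both \<open>P\<^sub>i\<close> vanish. Thus
  \<open>P\<^sub>1\<^sup>2 - P\<^sub>2\<^sup>2\<close> has \<open>2 q\<close> zeros but degree at most \<open>2 (q - 1)\<close>, which gives \<open>P\<^sub>1 = P\<^sub>2\<close> and
  \<open>B\<^sub>1 = B\<^sub>2\<close> (\<open>second_component_unique\<close>). Now \<open>N\<^sub>1 = \<plusminus> N\<^sub>2\<close>, and the sign is \<open>+\<close> because \<open>H B\<close>
  dominates \<open>Q A\<close> at infinity (\<open>components_unique\<close>).

  The argument uses that \<open>Q\<close> and \<open>D\<close> have only simple zeros, all of them real. Reality follows from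
  Green's identity for Floquet solutions. Zeros of \<open>Q\<close> are simple by the derivative of the Wronskian.
  For \<open>D\<close> the open gaps exclude a collision across a gap, and a collapsed band would give a local
  minimum of \<open>\<bar>\<Delta>\<bar>\<close> at height \<open>1\<close>, which the Laguerre inequality for the real-rooted polynomial
  \<open>\<Delta>\<close> forbids (\<open>edge_list_adjacent\<close>).
\<close>

section \<open>Polynomials determined by their zeros\<close>

lemma poly_eqI_order:
  fixes p q :: "complex poly"
  assumes "p \<noteq> 0" "q \<noteq> 0" "lead_coeff p = lead_coeff q" "\<And>z. order z p = order z q"
  shows "p = q"
proof -
  have "proots p = proots q" using assms by (intro multiset_eqI) simp
  then show ?thesis
    by (metis complex_poly_decompose_multiset assms(3))
qed

lemma order_prod_linear:
  fixes S :: "complex set"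
  assumes "finite S"
  shows "order z (\<Prod>x\<in>S. [:-x, 1:]) = (if z \<in> S then 1 else 0)"
  using assms
proof (induction S)
  case (insert x S)
  have "order z (\<Prod>x\<in>insert x S. [:-x, 1:]) = order z [:-x, 1:] + order z (\<Prod>x\<in>S. [:-x, 1:])"
    using insert.hyps by (simp add: order_mult del: mult_pCons_left)
  also have "order z [:-x, 1:] = (if z = x then 1 else 0)"
    using order_power_n_n[of x 1] by (simp add: order_0I)
  finally show ?case using insert by auto
qed simp

lemma double_zero_sq_dvd:
  fixes p :: "complex poly"
  assumes "poly p z = 0" shows "[:-z, 1:]\<^sup>2 dvd p\<^sup>2"
  using assms by (intro dvd_power_same) (simp add: poly_eq_0_iff_dvd)

lemma squarefree_dvdI:
  fixes d p :: "complex poly"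
  assumes "rsquarefree d" and "\<And>z. poly d z = 0 \<Longrightarrow> poly p z = 0"
  shows "d dvd p"
proof (cases "p = 0")
  case False
  have nz: "d \<noteq> 0" using assms(1) by (simp add: rsquarefree_def)
  have "proots d \<subseteq># proots p"
  proof (rule mset_subset_eqI)
    fix x
    show "count (proots d) x \<le> count (proots p) x"
      using False nz assms order_root[of p x] order_root[of d x]
      by (cases "poly d x = 0") (auto simp: rsquarefree_root_order)
  qed
  then have "(\<Prod>y\<in>#proots d. [:-y, 1:]) dvd (\<Prod>y\<in>#proots p. [:-y, 1:])"
    by (intro prod_mset_subset_imp_dvd image_mset_subseteq_mono)
  then have "smult (lead_coeff d) (\<Prod>y\<in>#proots d. [:-y, 1:]) dvd smult (lead_coeff p) (\<Prod>y\<in>#proots p. [:-y, 1:])"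
    using nz by (intro smult_dvd dvd_smult) auto
  then show ?thesis unfolding complex_poly_decompose_multiset .
qed simp

section \<open>Algebra of a pair with given product\<close>

text \<open>
  The part of the argument that concerns only polynomials and the curve \<open>w\<^sup>2 = - D(z)\<close>; for the
  periodic background \<open>Q = \<phi>\<^sub>q\<close>, \<open>H = (\<phi>\<^sub>q\<^sub>+\<^sub>1 - \<theta>\<^sub>q) / 2\<close>, \<open>T = \<theta>\<^sub>q\<^sub>+\<^sub>1\<close>, \<open>D = \<Delta>\<^sup>2 - 1\<close>.
\<close>
locale spectral_data =
  fixes D Q H T :: "complex poly"
  assumes curve_identity: "H\<^sup>2 + Q * T = D"
    and D_squarefree: "rsquarefree D"
    and Q_squarefree: "rsquarefree Q"
    and degree_Q_H: "degree Q < degree H"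
    and degree_Q_D: "2 * degree Q < degree D"
begin

text \<open>
  For \<open>f = (half_trace A B + i w B) / Q\<close> on the curve, \<open>half_trace A B\<close> is the part of \<open>Q f\<close> that is
  even under the exchange of sheets.
\<close>
definition half_trace :: "complex poly \<Rightarrow> complex poly \<Rightarrow> complex poly" where
  "half_trace A B = Q * A + H * B"

text \<open>
  The polynomial \<open>F = Q f\<^sup>+ f\<^sup>-\<close> for \<open>f\<^sup>\<plusminus> = A + (H \<plusminus> i w) B / Q\<close>.
\<close>
definition jost_product :: "complex poly \<Rightarrow> complex poly \<Rightarrow> complex poly" where
  "jost_product A B = Q * A\<^sup>2 + 2 * H * A * B - T * B\<^sup>2"

lemma Q_nonzero: "Q \<noteq> 0" and D_nonzero: "D \<noteq> 0"
  using Q_squarefree D_squarefree by (auto simp: rsquarefree_def)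

text \<open>
  The left side is the product of \<open>N + i w B\<close> over the two sheets, where \<open>N = half_trace A B\<close>.
\<close>
lemma norm_identity: "(half_trace A B)\<^sup>2 - D * B\<^sup>2 = Q * jost_product A B"
  unfolding half_trace_def jost_product_def curve_identity[symmetric] by (simp add: power2_eq_square algebra_simps)

lemma order_D: "poly D z = 0 \<Longrightarrow> order z D = 1"
  and order_Q: "poly Q z = 0 \<Longrightarrow> order z Q = 1"
  using D_squarefree Q_squarefree D_nonzero Q_nonzero
  by (auto simp: rsquarefree_root_order)

lemma Q_D_common_root: "poly Q z = 0 \<Longrightarrow> poly D z = 0 \<Longrightarrow> poly H z = 0"
  by (simp flip: curve_identity)

text \<open>
  Opposite half traces would mean \<open>2 H B = - Q (A1 + A2)\<close>, which the degrees exclude: this is where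
  the asymptotics at infinity tell \<open>f\<^sup>+\<close> from \<open>- f\<^sup>-\<close>.
\<close>
lemma half_traces_eq_or_opposite_imp_eq:
  assumes "half_trace A1 B = half_trace A2 B \<or> half_trace A1 B = - half_trace A2 B"
    and "B \<noteq> 0" "degree A1 \<le> degree B" "degree A2 \<le> degree B"
  shows "A1 = A2"
  using assms(1)
proof
  assume "half_trace A1 B = half_trace A2 B"
  then show ?thesis using Q_nonzero by (simp add: half_trace_def)
next
  assume "half_trace A1 B = - half_trace A2 B"
  then have eq: "2 * (H * B) = - (Q * (A1 + A2))" 
    unfolding half_trace_def by (simp add: algebra_simps eq_neg_iff_add_eq_0)
  have "H \<noteq> 0" using degree_Q_H by auto
  then have "degree (2 * (H * B)) = degree H + degree B"
    using assms(2) by (simp add: degree_mult_eq mult_2[symmetric] numeral_poly)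
  moreover have "degree (- (Q * (A1 + A2))) \<le> degree Q + degree B"
    unfolding degree_minus
    by (rule order.trans[OF degree_mult_le]) (simp add: assms degree_add_le)
  ultimately show ?thesis using eq degree_Q_H by simp
qed

text \<open>
  The zeros of \<open>Q\<close> that are not zeros of \<open>D\<close> may or may not be zeros of \<open>B\<close>. This finite ambiguity is
  carried by two divisors \<open>P1\<close>, \<open>P2\<close> of \<open>Q\<close>, and they agree because \<open>P1\<^sup>2 - P2\<^sup>2\<close> vanishes at more points
  than its degree allows.
\<close>
lemma second_component_unique:
  assumes lead: "lead_coeff B1 = lead_coeff B2" "B1 \<noteq> 0" "B2 \<noteq> 0"
    and F: "jost_product A1 B1 = jost_product A2 B2"
    and edge: "\<And>z. poly D z = 0 \<Longrightarrow> poly Q z \<noteq> 0 \<Longrightarrow>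
        poly (half_trace A1 B1) z = 0 \<and> poly (half_trace A2 B2) z = 0 \<and> poly B1 z \<noteq> 0 \<and> poly B2 z \<noteq> 0"
    and dir: "\<And>z. poly D z \<noteq> 0 \<Longrightarrow> poly Q z = 0 \<Longrightarrow> order z B1 \<le> 1 \<and> order z B2 \<le> 1"
    and rest: "\<And>z. (poly D z = 0 \<longleftrightarrow> poly Q z = 0) \<Longrightarrow> order z B1 = order z B2"
  shows "B1 = B2"
proof -
  \<comment> \<open>Zeros of \<open>D\<close> are put into both sets, so that \<open>P1\<close> and \<open>P2\<close> vanish at every common zero of \<open>Q\<close> and
    \<open>D\<close>; the factors cancel from \<open>B1 P2 = B2 P1\<close>.\<close>
  define E1 where "E1 = {z. poly Q z = 0 \<and> (poly D z = 0 \<or> poly B1 z = 0)}"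
  define E2 where "E2 = {z. poly Q z = 0 \<and> (poly D z = 0 \<or> poly B2 z = 0)}"
  define P1 where "P1 = (\<Prod>x\<in>E1. [:-x, 1:])"
  define P2 where "P2 = (\<Prod>x\<in>E2. [:-x, 1:])"
  have finQ: "finite {z. poly Q z = 0}" using Q_nonzero by (rule poly_roots_finite)
  have fin: "finite E1" "finite E2"
    by (auto intro: finite_subset[OF _ finQ] simp: E1_def E2_def)
  have monic: "lead_coeff P1 = 1" "lead_coeff P2 = 1" unfolding P1_def P2_def by (simp_all add: lead_coeff_prod)
  then have nz: "P1 \<noteq> 0" "P2 \<noteq> 0" by auto
  have cross: "B1 * P2 = B2 * P1"
  proof (rule poly_eqI_order)
    show "lead_coeff (B1 * P2) = lead_coeff (B2 * P1)" using lead monic by (simp add: lead_coeff_mult)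
    fix z
    have "order z B1 + (if z \<in> E2 then 1 else 0) = order z B2 + (if z \<in> E1 then 1 else 0)"
    proof (cases "poly D z = 0 \<longleftrightarrow> poly Q z = 0")
      case True
      then show ?thesis using rest[of z] by (auto simp: E1_def E2_def)
    next
      case False
      show ?thesis
      proof (cases "poly Q z = 0")
        case True
        then show ?thesis using False dir[of z] lead order_root[of B1 z] order_root[of B2 z]
          by (auto simp: E1_def E2_def)
      next
        case False
        then show ?thesis using \<open>\<not> (poly D z = 0 \<longleftrightarrow> poly Q z = 0)\<close> edge[of z]
          by (auto simp: E1_def E2_def order_0I)
      qed
    qed
    then show "order z (B1 * P2) = order z (B2 * P1)"
      using nz lead fin by (simp add: order_mult P1_def P2_def order_prod_linear)
  qed (use nz lead in auto)
  have "D dvd P1\<^sup>2 - P2\<^sup>2"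
  proof (rule squarefree_dvdI[OF D_squarefree])
    fix z assume z: "poly D z = 0"
    show "poly (P1\<^sup>2 - P2\<^sup>2) z = 0"
    proof (cases "poly Q z = 0")
      case True
      with z have "z \<in> E1" "z \<in> E2" by (auto simp: E1_def E2_def)
      then have "poly P1 z = 0" "poly P2 z = 0" using fin by (auto simp: P1_def P2_def poly_prod)
      then show ?thesis by simp
    next
      case False
      note e = edge[OF z False]
      have "(half_trace A1 B1)\<^sup>2 - (half_trace A2 B2)\<^sup>2 = D * (B1\<^sup>2 - B2\<^sup>2)"
        using norm_identity[of A1 B1] norm_identity[of A2 B2] F by (simp add: algebra_simps)
      moreover have "[:-z, 1:]\<^sup>2 dvd (half_trace A1 B1)\<^sup>2 - (half_trace A2 B2)\<^sup>2"
        using e by (intro dvd_diff double_zero_sq_dvd) auto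
      ultimately have dvd: "[:-z, 1:]\<^sup>2 dvd D * (B1\<^sup>2 - B2\<^sup>2)" by simp
      have "poly (B1\<^sup>2 - B2\<^sup>2) z = 0"
      proof (cases "B1\<^sup>2 - B2\<^sup>2 = 0")
        case False
        then have "2 \<le> order z D + order z (B1\<^sup>2 - B2\<^sup>2)"
          using dvd D_nonzero order_divides[of z 2 "D * (B1\<^sup>2 - B2\<^sup>2)"] by (simp add: order_mult)
        then show ?thesis using order_D[OF z] order_0I[of "B1\<^sup>2 - B2\<^sup>2" z] by linarith
      qed simp
      then have "(poly B1 z)\<^sup>2 = (poly B2 z)\<^sup>2" by simp
      moreover have "poly B1 z * poly P2 z = poly B2 z * poly P1 z" using arg_cong[OF cross, of "\<lambda>p. poly p z"] by simp
      then have "(poly B1 z)\<^sup>2 * (poly P2 z)\<^sup>2 = (poly B2 z)\<^sup>2 * (poly P1 z)\<^sup>2"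
        by (simp flip: power_mult_distrib)
      ultimately show ?thesis using e by simp
    qed
  qed
  moreover have "degree (P1\<^sup>2 - P2\<^sup>2) < degree D"
  proof -
    have card: "card {z. poly Q z = 0} \<le> degree Q" using card_poly_roots_bound Q_nonzero by blast
    have "card E1 \<le> degree Q" "card E2 \<le> degree Q"
      by (rule order.trans[OF card_mono[OF finQ] card]; auto simp: E1_def E2_def)+
    then have "degree P1 \<le> degree Q" "degree P2 \<le> degree Q"
      unfolding P1_def P2_def by (simp_all add: degree_prod_sum_eq)
    then have "degree (P1\<^sup>2) \<le> 2 * degree Q" "degree (P2\<^sup>2) \<le> 2 * degree Q"
      using nz by (simp_all add: degree_power_eq)
    then have "degree (P1\<^sup>2 - P2\<^sup>2) \<le> 2 * degree Q" by (rule degree_diff_le)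
    then show ?thesis using degree_Q_D by linarith
  qed
  ultimately have "P1\<^sup>2 - P2\<^sup>2 = 0" using dvd_imp_degree_le[of D "P1\<^sup>2 - P2\<^sup>2"] by linarith
  then have "(P1 - P2) * (P1 + P2) = 0" by (simp add: algebra_simps power2_eq_square)
  moreover have "P1 + P2 \<noteq> 0"
  proof
    assume "P1 + P2 = 0"
    then have "P1 = - P2" by (simp add: eq_neg_iff_add_eq_0)
    then have "lead_coeff P1 = - lead_coeff P2" by simp
    then show False using monic by simp
  qed
  ultimately have "P1 = P2" by simp
  with cross nz show ?thesis by simp
qed

theorem components_unique:
  assumes lead: "lead_coeff B1 = lead_coeff B2" "B1 \<noteq> 0" "B2 \<noteq> 0"
    and deg: "degree A1 \<le> degree B1" "degree A2 \<le> degree B2"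
    and F: "jost_product A1 B1 = jost_product A2 B2"
    and edge: "\<And>z. poly D z = 0 \<Longrightarrow> poly Q z \<noteq> 0 \<Longrightarrow>
        poly (half_trace A1 B1) z = 0 \<and> poly (half_trace A2 B2) z = 0 \<and> poly B1 z \<noteq> 0 \<and> poly B2 z \<noteq> 0"
    and dir: "\<And>z. poly D z \<noteq> 0 \<Longrightarrow> poly Q z = 0 \<Longrightarrow> order z B1 \<le> 1 \<and> order z B2 \<le> 1"
    and rest: "\<And>z. (poly D z = 0 \<longleftrightarrow> poly Q z = 0) \<Longrightarrow> order z B1 = order z B2"
  shows "A1 = A2 \<and> B1 = B2"
proof -
  have B: "B1 = B2" by (rule second_component_unique[OF lead F edge dir rest])
  have "(half_trace A1 B2)\<^sup>2 - D * B2\<^sup>2 = (half_trace A2 B2)\<^sup>2 - D * B2\<^sup>2"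
    using F unfolding norm_identity B by (rule arg_cong)
  then have "(half_trace A1 B2)\<^sup>2 = (half_trace A2 B2)\<^sup>2" by (metis diff_add_cancel)
  then have "half_trace A1 B2 = half_trace A2 B2 \<or> half_trace A1 B2 = - half_trace A2 B2"
    by (simp only: power2_eq_iff)
  then have "A1 = A2" by (rule half_traces_eq_or_opposite_imp_eq) (use lead(3) deg B in simp_all)
  then show ?thesis using B by blast
qed

end

section \<open>Orders of analytic functions\<close>

lemma zorder_simple_zero:
  assumes "f analytic_on {z}" "f z = 0" "deriv f z \<noteq> 0"
  shows "zorder f z = 1"
proof -
  obtain S where "f holomorphic_on S" "open S" "z \<in> S" using assms(1) analytic_at by blast
  then show ?thesis using assms by (intro zorder_zero_eqI) auto
qed

text \<open>
  The local order of an injective map is \<open>1\<close>, whatever the map: this makes orders on the curve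
  computable for an arbitrary local parameter.
\<close>
lemma zorder_injective:
  assumes "f holomorphic_on ball z r" "r > 0" "inj_on f (ball z r)"
  shows "zorder (\<lambda>t. f t - f z) z = 1"
proof (rule zorder_simple_zero)
  have an: "f analytic_on {z}" using assms analytic_at by (metis centre_in_ball open_ball)
  then show "(\<lambda>t. f t - f z) analytic_on {z}" by (intro analytic_intros)
  have "deriv (\<lambda>t. f t - f z) z = deriv f z"
    using an by (subst deriv_diff) (auto intro: analytic_on_imp_differentiable_at)
  then show "deriv (\<lambda>t. f t - f z) z \<noteq> 0"
    using holomorphic_injective_imp_regular[OF assms(1) _ assms(3)] assms(2) by simp
qed simp

lemma analytic_poly_compose:
  fixes f :: "complex \<Rightarrow> complex"
  assumes "f analytic_on S" shows "(\<lambda>t. poly P (f t)) analytic_on S"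
proof -
  have "poly P analytic_on f ` S"
    by (rule analytic_on_subset[of _ UNIV]) (auto simp: analytic_on_open intro!: holomorphic_intros)
  then show ?thesis using analytic_on_compose[OF assms, of "poly P"] by (simp add: o_def)
qed

lemma zorder_poly_compose:
  assumes f: "f analytic_on {0}" "f 0 = z" "eventually (\<lambda>t. f t \<noteq> z) (at 0)" and P: "P \<noteq> 0"
  shows "eventually (\<lambda>t. poly P (f t) \<noteq> 0) (at 0)"
    and "zorder (\<lambda>t. poly P (f t)) 0 = int (order z P) * zorder (\<lambda>t. f t - z) 0"
proof -
  obtain R where R: "P = [:-z, 1:] ^ order z P * R" "\<not> [:-z, 1:] dvd R"
    using order_decomp[OF P] by blast
  then have Rz: "poly R z \<noteq> 0" by (simp add: poly_eq_0_iff_dvd)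
  have eq: "poly P (f t) = (f t - z) ^ order z P * poly R (f t)" for t
    by (subst R(1)) (simp add: poly_power)
  have anR: "(\<lambda>t. poly R (f t)) analytic_on {0}" and anf: "(\<lambda>t. f t - z) analytic_on {0}"
    using f by (auto intro!: analytic_intros analytic_poly_compose)
  have "isCont (\<lambda>t. poly R (f t)) 0" using anR by (rule analytic_at_imp_isCont)
  then have "eventually (\<lambda>t. poly R (f t) \<noteq> 0) (at 0)"
    using Rz f(2) by (intro tendsto_imp_eventually_ne[where c = "poly R z"]) (auto simp: isCont_def)
  with f(3) show ev: "eventually (\<lambda>t. poly P (f t) \<noteq> 0) (at 0)"
    by eventually_elim (simp add: eq)
  have fr: "frequently (\<lambda>t. f t - z \<noteq> 0) (at 0)"
    using f(3) by (intro eventually_frequently) auto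
  have "zorder (\<lambda>t. (f t - z) ^ order z P * poly R (f t)) 0
      = zorder (\<lambda>t. (f t - z) ^ order z P) 0 + zorder (\<lambda>t. poly R (f t)) 0"
    using ev anf anR by (intro zorder_times_analytic) (auto simp: eq intro!: analytic_intros)
  also have "zorder (\<lambda>t. poly R (f t)) 0 = 0" using anR Rz f(2) by (intro zorder_eq_0I) auto
  also have "zorder (\<lambda>t. (f t - z) ^ order z P) 0 = int (order z P) * zorder (\<lambda>t. f t - z) 0"
    using anf fr by (intro zorder_power) (auto intro: analytic_on_imp_meromorphic_on)
  finally show "zorder (\<lambda>t. poly P (f t)) 0 = int (order z P) * zorder (\<lambda>t. f t - z) 0"
    by (simp add: eq)
qed

section \<open>Local parameters of the curve\<close>

context spectral_data begin

definition curve :: "(complex \<times> complex) set" where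
  "curve = {(z, w). w\<^sup>2 = - poly D z}"

text \<open>
  The number of sheets of \<open>(z, w) \<mapsto> z\<close> that meet over \<open>z\<close>.
\<close>
definition ramification :: "complex \<Rightarrow> int" where
  "ramification z = (if poly D z = 0 then 2 else 1)"

text \<open>
  Off the branch points \<open>z\<close> is a coordinate and \<open>w\<close> a branch of the square root of \<open>- D\<close>. At a branch
  point \<open>D\<close> is locally invertible, being squarefree, and \<open>w\<close> is a coordinate.
\<close>
lemma local_param_exists:
  assumes "(z0, w0) \<in> curve"
  shows "\<exists>g. local_param curve (z0, w0) g"
proof (cases "poly D z0 = 0")
  case False
  then have w0: "w0 \<noteq> 0" "w0\<^sup>2 = - poly D z0" "poly D z0 \<noteq> 0" using assms by (auto simp: curve_def)
  have "isCont (\<lambda>z. - poly D z / w0\<^sup>2) z0" using w0 by (intro continuous_intros) auto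
  then obtain r where r: "r > 0" "\<And>z. dist z z0 < r \<Longrightarrow> dist (- poly D z / w0\<^sup>2) (- poly D z0 / w0\<^sup>2) < 1"
    unfolding continuous_at_eps_delta by (metis zero_less_one)
  \<comment> \<open>The principal branch is normalized by \<open>w0\<close>, so that its argument is near \<open>1\<close>.\<close>
  define h where "h z = w0 * csqrt (- poly D z / w0\<^sup>2)" for z
  define g where "g t = (z0 + t, h (z0 + t))" for t
  have one: "- poly D z0 / w0\<^sup>2 = 1" using w0(2,3) by (simp add: divide_eq_1_iff)
  have pos: "- poly D (z0 + t) / w0\<^sup>2 \<notin> \<real>\<^sub>\<le>\<^sub>0" if "t \<in> ball 0 r" for t
  proof
    assume "- poly D (z0 + t) / w0\<^sup>2 \<in> \<real>\<^sub>\<le>\<^sub>0"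
    then have "Re (- poly D (z0 + t) / w0\<^sup>2 - 1) \<le> -1" by (auto elim!: nonpos_Reals_cases nonneg_Reals_cases)
    moreover have "cmod (- poly D (z0 + t) / w0\<^sup>2 - 1) < 1"
      using r(2)[of "z0 + t"] that unfolding one by (simp add: dist_norm)
    ultimately show False using abs_Re_le_cmod[of "- poly D (z0 + t) / w0\<^sup>2 - 1"] by linarith
  qed
  have "local_param curve (z0, w0) g"
    unfolding local_param_def
  proof (intro conjI exI[of _ r])
    show "g 0 = (z0, w0)" unfolding g_def h_def using one by simp
    show "(\<lambda>t. fst (g t)) holomorphic_on ball 0 r" unfolding g_def by (auto intro!: holomorphic_intros)
    show "(\<lambda>t. snd (g t)) holomorphic_on ball 0 r" unfolding g_def h_def
      using pos w0 by (auto intro!: holomorphic_intros)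
    show "inj_on g (ball 0 r)" by (auto simp: inj_on_def g_def)
    show "g ` ball 0 r \<subseteq> curve" using w0 by (auto simp: g_def curve_def h_def power_mult_distrib)
  qed (rule r)
  then show ?thesis by blast
next
  case True
  then have w0: "w0 = 0" using assms by (auto simp: curve_def)
  have "poly (pderiv D) z0 \<noteq> 0" using True D_squarefree by (auto simp: rsquarefree_roots)
  then have der: "deriv (poly D) z0 \<noteq> 0" using DERIV_imp_deriv[OF poly_DERIV[of D z0]] by simp
    have "poly D holomorphic_on UNIV" by (auto intro!: holomorphic_intros)
    from has_complex_derivative_locally_injective[OF this UNIV_I open_UNIV der]
    obtain r where r: "r > 0" "inj_on (poly D) (ball z0 r)" by blast
  have holD: "poly D holomorphic_on ball z0 r" by (auto intro!: holomorphic_intros)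
  obtain inv where inv: "inv holomorphic_on (poly D ` ball z0 r)" "\<And>z. z \<in> ball z0 r \<Longrightarrow> inv (poly D z) = z"
    using holomorphic_has_inverse[OF holD open_ball r(2)] by metis
  have "open (poly D ` ball z0 r)" by (rule open_mapping_thm3[OF holD open_ball r(2)])
  moreover have "0 \<in> poly D ` ball z0 r" using True r(1) by (force intro: image_eqI[of _ _ z0])
  ultimately obtain e where e: "e > 0" "ball 0 e \<subseteq> poly D ` ball z0 r" by (meson openE)
  \<comment> \<open>With \<open>\<bar>t\<bar> < 1\<close> the square \<open>t\<^sup>2\<close> stays in the ball of radius \<open>e\<close> together with \<open>t\<close>.\<close>
  define r' where "r' = min 1 e"
  have r': "r' > 0" "- (t\<^sup>2) \<in> poly D ` ball z0 r" if "t \<in> ball 0 r'" for t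
  proof -
    show "r' > 0" using e by (simp add: r'_def)
    have "cmod t < 1" "cmod t < e" using that by (auto simp: r'_def)
    then have "cmod (- (t\<^sup>2)) < e"
      using mult_left_le_one_le[of "cmod t" "cmod t"] by (simp add: norm_power power2_eq_square norm_mult)
    then show "- (t\<^sup>2) \<in> poly D ` ball z0 r" using e(2) by auto
  qed
  define g where "g t = (inv (- (t\<^sup>2)), t)" for t
  have "local_param curve (z0, w0) g"
    unfolding local_param_def
  proof (intro conjI exI[of _ r'])
    show "r' > 0" using e by (simp add: r'_def)
    show "g 0 = (z0, w0)" using inv(2)[of z0] r(1) True w0 by (simp add: g_def)
    have "(inv \<circ> (\<lambda>t. - (t\<^sup>2))) holomorphic_on ball 0 r'"
      using r' by (intro holomorphic_on_compose_gen[OF _ inv(1)]) (auto intro!: holomorphic_intros)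
    then show "(\<lambda>t. fst (g t)) holomorphic_on ball 0 r'" by (simp add: g_def o_def)
    show "(\<lambda>t. snd (g t)) holomorphic_on ball 0 r'" unfolding g_def by (auto intro!: holomorphic_intros)
    show "inj_on g (ball 0 r')" by (auto simp: inj_on_def g_def)
    show "g ` ball 0 r' \<subseteq> curve"
    proof clarify
      fix t z w assume t: "t \<in> ball 0 r'" and zw: "(z, w) = g t"
      obtain y where "y \<in> ball z0 r" "- (t\<^sup>2) = poly D y" using r'(2)[OF t] by auto
      then have "poly D (inv (- (t\<^sup>2))) = - (t\<^sup>2)" using inv(2) by metis
      then show "(z, w) \<in> curve" using zw by (simp add: g_def curve_def)
    qed
  qed
  then show ?thesis by blast
qed

context
  fixes z0 w0 :: complex and g :: "complex \<Rightarrow> complex \<times> complex"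
  assumes g: "local_param curve (z0, w0) g"
begin

lemma local_param_analytic:
  "(\<lambda>t. fst (g t)) analytic_on {0}" "(\<lambda>t. snd (g t)) analytic_on {0}"
proof -
  obtain r where "r > 0" "(\<lambda>t. fst (g t)) holomorphic_on ball 0 r" "(\<lambda>t. snd (g t)) holomorphic_on ball 0 r"
    using g by (auto simp: local_param_def)
  then show "(\<lambda>t. fst (g t)) analytic_on {0}" "(\<lambda>t. snd (g t)) analytic_on {0}"
    using analytic_at by (metis centre_in_ball open_ball)+
qed

lemma local_param_center: "fst (g 0) = z0" "snd (g 0) = w0"
  using g by (auto simp: local_param_def)

lemma local_param_on_curve: "eventually (\<lambda>t. (snd (g t))\<^sup>2 = - poly D (fst (g t))) (at 0)"
proof -
  obtain r where r: "r > 0" "g ` ball 0 r \<subseteq> curve"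
    using g by (auto simp: local_param_def)
  have "eventually (\<lambda>t. t \<in> ball 0 r) (at (0::complex))"
    using r(1) by (intro eventually_at_in_open') auto
  then show ?thesis
  proof eventually_elim
    case (elim t)
    then have "g t \<in> curve" using r(2) by blast
    then show ?case by (auto simp: curve_def split: prod.splits)
  qed
qed

lemma curve_center: "w0\<^sup>2 = - poly D z0"
proof -
  obtain r where "r > 0" "g ` ball 0 r \<subseteq> curve" using g unfolding local_param_def by blast
  then have "g 0 \<in> curve" by (meson centre_in_ball image_subset_iff)
  then show ?thesis using g by (simp add: local_param_def curve_def)
qed

text \<open>
  Near a point with \<open>D \<noteq> 0\<close> the first coordinate of a point of the curve determines the second, and near
  a branch point the second determines the first. So one component of an injective parametrization
  is itself injective, and the equation of the curve yields the order of the other.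
\<close>
lemma local_param_orders:
  "eventually (\<lambda>t. fst (g t) \<noteq> z0) (at 0)"
  "zorder (\<lambda>t. fst (g t) - z0) 0 = ramification z0"
  "eventually (\<lambda>t. snd (g t) \<noteq> 0) (at 0)"
  "zorder (\<lambda>t. snd (g t)) 0 = ramification z0 - 1"
proof -
  obtain r where r: "r > 0" "(\<lambda>t. fst (g t)) holomorphic_on ball 0 r"
      "(\<lambda>t. snd (g t)) holomorphic_on ball 0 r" "inj_on g (ball 0 r)" "g ` ball 0 r \<subseteq> curve"
    using g by (auto simp: local_param_def)
  have on: "(snd (g t))\<^sup>2 = - poly D (fst (g t))" if "t \<in> ball 0 r" for t
    using r(5) that by (force simp: curve_def)
  have cont: "isCont (\<lambda>t. fst (g t)) 0" "isCont (\<lambda>t. snd (g t)) 0"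
    using local_param_analytic by (auto intro: analytic_at_imp_isCont)
  have "eventually (\<lambda>t. fst (g t) \<noteq> z0) (at 0) \<and> zorder (\<lambda>t. fst (g t) - z0) 0 = ramification z0 \<and>
        eventually (\<lambda>t. snd (g t) \<noteq> 0) (at 0) \<and> zorder (\<lambda>t. snd (g t)) 0 = ramification z0 - 1"
  proof (cases "poly D z0 = 0")
    case False
    then have w0: "w0 \<noteq> 0" using curve_center by auto
    \<comment> \<open>In a disc about \<open>w0\<close> that avoids \<open>0\<close> no point is the negative of another.\<close>
    obtain d where d: "d > 0" "\<And>t. dist t 0 < d \<Longrightarrow> dist (snd (g t)) w0 < cmod w0"
      using cont(2) w0 unfolding continuous_at_eps_delta local_param_center by (metis zero_less_norm_iff)
    define r' where "r' = min r d"
    have r': "r' > 0" using r(1) d(1) by (simp add: r'_def)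
    have inj: "inj_on (\<lambda>t. fst (g t)) (ball 0 r')"
    proof (rule inj_onI)
      fix s t assume s: "s \<in> ball 0 r'" and t: "t \<in> ball 0 r'" and eq: "fst (g s) = fst (g t)"
      have "(snd (g s))\<^sup>2 = (snd (g t))\<^sup>2" using on[of s] on[of t] s t eq by (simp add: r'_def)
      moreover have "snd (g s) \<noteq> - snd (g t)"
      proof
        assume "snd (g s) = - snd (g t)"
        then have "2 * w0 = (w0 - snd (g s)) + (w0 - snd (g t))" by simp
        then have "cmod (2 * w0) \<le> cmod (w0 - snd (g s)) + cmod (w0 - snd (g t))"
          by (metis norm_triangle_ineq)
        moreover have "cmod (w0 - snd (g s)) < cmod w0" "cmod (w0 - snd (g t)) < cmod w0"
          using d(2)[of s] d(2)[of t] s t by (auto simp: r'_def dist_norm norm_minus_commute)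
        ultimately show False by (simp add: norm_mult)
      qed
      ultimately have "snd (g s) = snd (g t)" by (simp add: power2_eq_iff)
      then have "g s = g t" using eq by (simp add: prod_eq_iff)
      then show "s = t" using r(4) s t by (auto simp: inj_on_def r'_def)
    qed
    have "zorder (\<lambda>t. fst (g t) - fst (g 0)) 0 = 1"
      using r(2) r' inj by (intro zorder_injective) (auto simp: r'_def intro: holomorphic_on_subset)
    moreover have "eventually (\<lambda>t. fst (g t) \<noteq> z0) (at 0)"
    proof -
      have "eventually (\<lambda>t. t \<in> ball 0 r' - {0}) (at (0::complex))"
        using r' by (intro eventually_at_in_open) auto
      then show ?thesis
        by eventually_elim (use inj r' in \<open>force simp: inj_on_def local_param_center[symmetric]\<close>)
    qed
    moreover have "eventually (\<lambda>t. snd (g t) \<noteq> 0) (at 0)"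
      using cont(2) w0 local_param_center
      by (intro tendsto_imp_eventually_ne[where c = w0]) (auto simp: isCont_def)
    moreover have "zorder (\<lambda>t. snd (g t)) 0 = 0"
      using local_param_analytic(2) w0 local_param_center by (intro zorder_eq_0I) auto
    ultimately show ?thesis using False by (simp add: ramification_def local_param_center)
  next
    case True
    then have w0: "w0 = 0" using curve_center by auto
    have "poly (pderiv D) z0 \<noteq> 0" using True D_squarefree by (auto simp: rsquarefree_roots)
    then have der: "deriv (poly D) z0 \<noteq> 0" using DERIV_imp_deriv[OF poly_DERIV[of D z0]] by simp
    have "poly D holomorphic_on UNIV" by (auto intro!: holomorphic_intros)
    from has_complex_derivative_locally_injective[OF this UNIV_I open_UNIV der]
    obtain e where e: "e > 0" "inj_on (poly D) (ball z0 e)" by blast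
    obtain d where d: "d > 0" "\<And>t. dist t 0 < d \<Longrightarrow> dist (fst (g t)) z0 < e"
      using cont(1) e(1) unfolding continuous_at_eps_delta local_param_center by metis
    define r' where "r' = min r d"
    have r': "r' > 0" using r(1) d(1) by (simp add: r'_def)
    have inj: "inj_on (\<lambda>t. snd (g t)) (ball 0 r')"
    proof (rule inj_onI)
      fix s t assume s: "s \<in> ball 0 r'" and t: "t \<in> ball 0 r'" and eq: "snd (g s) = snd (g t)"
      have "poly D (fst (g s)) = poly D (fst (g t))" using on[of s] on[of t] s t eq by (simp add: r'_def)
      moreover have "fst (g s) \<in> ball z0 e" "fst (g t) \<in> ball z0 e"
        using d(2)[of s] d(2)[of t] s t by (auto simp: r'_def dist_commute)
      ultimately have "fst (g s) = fst (g t)" using e(2) by (auto simp: inj_on_def)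
      then have "g s = g t" using eq by (simp add: prod_eq_iff)
      then show "s = t" using r(4) s t by (auto simp: inj_on_def r'_def)
    qed
    have ord: "zorder (\<lambda>t. snd (g t) - snd (g 0)) 0 = 1"
      using r(3) r' inj by (intro zorder_injective) (auto simp: r'_def intro: holomorphic_on_subset)
    have ev: "eventually (\<lambda>t. snd (g t) \<noteq> 0) (at 0)"
    proof -
      have "eventually (\<lambda>t. t \<in> ball 0 r' - {0}) (at (0::complex))"
        using r' by (intro eventually_at_in_open) auto
      then show ?thesis
        by eventually_elim (use inj r' w0 in \<open>force simp: inj_on_def local_param_center(2)[symmetric]\<close>)
    qed
    have ev1: "eventually (\<lambda>t. fst (g t) \<noteq> z0) (at 0)"
      using ev local_param_on_curve by eventually_elim (use True in auto)
    have "zorder (\<lambda>t. - poly D (fst (g t))) 0 = zorder (\<lambda>t. (snd (g t))\<^sup>2) 0"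
      using local_param_on_curve by (intro zorder_cong) (auto elim: eventually_mono)
    also have "\<dots> = int 2 * zorder (\<lambda>t. snd (g t)) 0"
      using local_param_analytic(2) ev
      by (intro zorder_power) (auto intro: analytic_on_imp_meromorphic_on eventually_frequently)
    also have "zorder (\<lambda>t. snd (g t)) 0 = 1" using ord w0 local_param_center by simp
    finally have "zorder (\<lambda>t. poly D (fst (g t))) 0 = 2" by simp
    then have "zorder (\<lambda>t. fst (g t) - z0) 0 = 2"
      using zorder_poly_compose(2)[OF local_param_analytic(1) local_param_center(1) ev1 D_nonzero] order_D[OF True]
      by simp
    then show ?thesis using ev ev1 ord w0 True local_param_center by (simp add: ramification_def)
  qed
  then show "eventually (\<lambda>t. fst (g t) \<noteq> z0) (at 0)"
    "zorder (\<lambda>t. fst (g t) - z0) 0 = ramification z0"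
    "eventually (\<lambda>t. snd (g t) \<noteq> 0) (at 0)"
    "zorder (\<lambda>t. snd (g t)) 0 = ramification z0 - 1" by blast+
qed

end

end

section \<open>Orders of the scattering matrix minus one\<close>

context spectral_data begin

text \<open>
  \<open>Q f\<^sup>\<plusminus>\<close> for \<open>s = \<plusminus>1\<close>: unlike \<open>f\<^sup>\<plusminus>\<close>, it has no poles.
\<close>
definition jost_numerator :: "complex \<Rightarrow> complex poly \<Rightarrow> complex poly \<Rightarrow> complex \<times> complex \<Rightarrow> complex" where
  "jost_numerator s A B x = poly (half_trace A B) (fst x) + s * \<i> * snd x * poly B (fst x)"

lemma numerator_product:
  assumes "w\<^sup>2 = - poly D z"
  shows "jost_numerator 1 A B (z, w) * jost_numerator (-1) A B (z, w) = poly (Q * jost_product A B) z"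
proof -
  have "jost_numerator 1 A B (z, w) * jost_numerator (-1) A B (z, w)
      = (poly (half_trace A B) z)\<^sup>2 + w\<^sup>2 * (poly B z)\<^sup>2"
    unfolding jost_numerator_def by (simp add: power2_eq_square algebra_simps)
  also have "\<dots> = poly ((half_trace A B)\<^sup>2 - D * B\<^sup>2) z" using assms by simp
  finally show ?thesis unfolding norm_identity .
qed

text \<open>
  If \<open>F\<close> were zero, \<open>D B\<^sup>2\<close> would be a square, but its order at a zero of \<open>D\<close> is odd.
\<close>
lemma jost_product_nonzero:
  assumes "B \<noteq> 0" shows "jost_product A B \<noteq> 0"
proof
  assume "jost_product A B = 0"
  then have eq: "(half_trace A B)\<^sup>2 = D * B\<^sup>2" using norm_identity[of A B] by simp
  have "degree D \<noteq> 0" using degree_Q_D by simp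
  then obtain z where z: "poly D z = 0" using fundamental_theorem_of_algebra constant_degree by metis
  have "D * B\<^sup>2 \<noteq> 0" using assms D_nonzero by simp
  then have ht: "half_trace A B \<noteq> 0" using eq by auto
  have "order z ((half_trace A B)\<^sup>2) = 2 * order z (half_trace A B)"
    using ht by (simp add: power2_eq_square order_mult)
  moreover have "order z (D * B\<^sup>2) = 1 + 2 * order z B"
    using assms D_nonzero order_D[OF z] by (simp add: power2_eq_square order_mult)
  ultimately show False using eq by (metis even_Suc dvd_triv_left plus_1_eq_Suc)
qed

text \<open>
  \<open>F\<close> is a quadratic form in \<open>A\<close> and \<open>B\<close>; so simple zeros of \<open>F\<close> mean that \<open>A\<close> and \<open>B\<close> have no common
  zero.
\<close>
lemma common_zero_is_double:
  assumes "poly A z = 0" "poly B z = 0" "B \<noteq> 0"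
  shows "order z (jost_product A B) \<ge> 2"
proof -
  have d: "[:-z, 1:] dvd A" "[:-z, 1:] dvd B" using assms by (simp_all add: poly_eq_0_iff_dvd)
  have "[:-z, 1:]\<^sup>2 dvd A\<^sup>2" "[:-z, 1:]\<^sup>2 dvd A * B" "[:-z, 1:]\<^sup>2 dvd B\<^sup>2"
    using d by (auto simp: power2_eq_square intro: mult_dvd_mono simp del: mult_pCons_left mult_pCons_right)
  moreover have "jost_product A B = A\<^sup>2 * Q + (A * B) * (2 * H) - B\<^sup>2 * T"
    by (simp add: jost_product_def ac_simps)
  ultimately have "[:-z, 1:]\<^sup>2 dvd jost_product A B" by (simp only: dvd_add dvd_diff dvd_mult2)
  then show ?thesis using jost_product_nonzero[OF assms(3), of A] by (simp add: order_divides)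
qed

context
  fixes A B :: "complex poly" and z0 w0 :: complex and g :: "complex \<Rightarrow> complex \<times> complex"
  assumes B_nonzero: "B \<noteq> 0"
    and simple: "\<And>z. poly (jost_product A B) z = 0 \<Longrightarrow> order z (jost_product A B) = 1"
    and g: "local_param curve (z0, w0) g"
begin

abbreviation (input) "G s t \<equiv> jost_numerator s A B (g t)"

lemma numerator_analytic: "(\<lambda>t. G s t) analytic_on {0}"
  unfolding jost_numerator_def
  by (intro analytic_intros analytic_poly_compose local_param_analytic[OF g])

lemma numerators_nonzero:
  "eventually (\<lambda>t. G 1 t * G (-1) t \<noteq> 0) (at 0)"
  and zorder_numerator_product:
  "zorder (\<lambda>t. G 1 t) 0 + zorder (\<lambda>t. G (-1) t) 0
     = int (order z0 (Q * jost_product A B)) * ramification z0"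
proof -
  have nz: "Q * jost_product A B \<noteq> 0" using Q_nonzero jost_product_nonzero[OF B_nonzero] by simp
  note c = zorder_poly_compose[OF local_param_analytic(1)[OF g] local_param_center(1)[OF g]
      local_param_orders(1)[OF g] nz]
  have eq: "eventually (\<lambda>t. G 1 t * G (-1) t = poly (Q * jost_product A B) (fst (g t))) (at 0)"
    using local_param_on_curve[OF g]
    by eventually_elim (metis numerator_product prod.collapse)
  show ev: "eventually (\<lambda>t. G 1 t * G (-1) t \<noteq> 0) (at 0)"
    using eq c(1) by eventually_elim metis
  have "zorder (\<lambda>t. G 1 t * G (-1) t) 0 = zorder (\<lambda>t. poly (Q * jost_product A B) (fst (g t))) 0"
    using eq by (rule zorder_cong) simp
  then show "zorder (\<lambda>t. G 1 t) 0 + zorder (\<lambda>t. G (-1) t) 0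
     = int (order z0 (Q * jost_product A B)) * ramification z0"
    using zorder_times_analytic[OF numerator_analytic numerator_analytic ev] c(2)
      local_param_orders(2)[OF g] by simp
qed

lemma numerators_eventually_nonzero:
  "eventually (\<lambda>t. G 1 t \<noteq> 0) (at 0)" "eventually (\<lambda>t. G (-1) t \<noteq> 0) (at 0)"
  using numerators_nonzero by (auto elim: eventually_mono)

text \<open>
  A common zero of \<open>Q\<close> and \<open>B\<close> splits off from both numerators, as \<open>Q A + B (H \<plusminus> i w)\<close> is a combination of
  \<open>Q\<close> and \<open>B\<close>.
\<close>
lemma zorder_numerator_ge:
  assumes "poly Q z0 = 0" "poly B z0 = 0" "eventually (\<lambda>t. G s t \<noteq> 0) (at 0)"
  shows "zorder (\<lambda>t. G s t) 0 \<ge> ramification z0"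
proof -
  obtain Q' B' where QB: "Q = [:-z0, 1:] * Q'" "B = [:-z0, 1:] * B'"
    using assms by (auto simp: poly_eq_0_iff_dvd elim!: dvdE)
  have Qp: "poly Q z = (z - z0) * poly Q' z" and Bp: "poly B z = (z - z0) * poly B' z" for z
    unfolding QB poly_mult by simp_all
  define K where "K t = poly Q' (fst (g t)) * poly A (fst (g t)) + poly H (fst (g t)) * poly B' (fst (g t))
    + s * \<i> * snd (g t) * poly B' (fst (g t))" for t
  have eq: "G s t = (fst (g t) - z0) * K t" for t
    unfolding jost_numerator_def half_trace_def K_def by (simp add: Qp Bp algebra_simps)
  have anK: "K analytic_on {0}" unfolding K_def
    by (intro analytic_intros analytic_poly_compose local_param_analytic[OF g])
  have an: "(\<lambda>t. fst (g t) - z0) analytic_on {0}"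
    by (intro analytic_intros local_param_analytic[OF g])
  have "frequently (\<lambda>t. K t \<noteq> 0) (at 0)"
    using assms(3) by (intro eventually_frequently) (auto simp: eq elim: eventually_mono)
  then have "zorder K 0 \<ge> 0" using anK by (rule zorder_ge_0[rotated])
  moreover have "zorder (\<lambda>t. G s t) 0 = ramification z0 + zorder K 0"
    using zorder_times_analytic[OF an anK] assms(3) local_param_orders(2)[OF g] by (simp add: eq)
  ultimately show ?thesis by simp
qed

text \<open>
  At a common zero of \<open>Q\<close> and \<open>B\<close> the product \<open>Q F\<close> of the two numerators vanishes to order exactly two in
  \<open>z\<close>, and each numerator to order at least one; hence each does so to order exactly one. At any other zero
  of \<open>B\<close>, the value of \<open>A\<close> is nonzero and the numerator is \<open>Q A \<noteq> 0\<close>.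
\<close>
lemma zorder_numerator_at_zero_of_B:
  assumes B: "poly B z0 = 0"
  shows "zorder (\<lambda>t. G 1 t) 0 = (if poly Q z0 = 0 then ramification z0 else 0)"
proof (cases "poly Q z0 = 0")
  case True
  have "poly (jost_product A B) z0 = 0" using B True by (simp add: jost_product_def)
  then have "order z0 (Q * jost_product A B) = 2"
    using order_Q[OF True] simple Q_nonzero jost_product_nonzero[OF B_nonzero] by (simp add: order_mult)
  then have "zorder (\<lambda>t. G 1 t) 0 + zorder (\<lambda>t. G (-1) t) 0 = 2 * ramification z0"
    using zorder_numerator_product by simp
  then show ?thesis
    using True zorder_numerator_ge[OF True B numerators_eventually_nonzero(1)]
      zorder_numerator_ge[OF True B numerators_eventually_nonzero(2)] by simp
next
  case False
  have "poly A z0 \<noteq> 0"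
  proof
    assume A: "poly A z0 = 0"
    then have "poly (jost_product A B) z0 = 0" using B by (simp add: jost_product_def)
    then show False using simple[of z0] common_zero_is_double[OF A B B_nonzero] by simp
  qed
  then have "G 1 0 \<noteq> 0"
    using False B by (simp add: jost_numerator_def half_trace_def local_param_center[OF g])
  then show ?thesis using False numerator_analytic by (simp add: zorder_eq_0I)
qed

lemma zorder_scattering:
  "zorder (\<lambda>t. G (-1) t / G 1 t - 1) 0
     = ramification z0 - 1 + int (order z0 B) * ramification z0 - zorder (\<lambda>t. G 1 t) 0"
  (is "?l = _")
proof -
  define P where "P t = snd (g t) * poly B (fst (g t))" for t
  note c = zorder_poly_compose[OF local_param_analytic(1)[OF g] local_param_center(1)[OF g]
      local_param_orders(1)[OF g] B_nonzero]
  have anB: "(\<lambda>t. poly B (fst (g t))) analytic_on {0}"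
    by (intro analytic_poly_compose local_param_analytic[OF g])
  have Pnz: "eventually (\<lambda>t. P t \<noteq> 0) (at 0)"
    using c(1) local_param_orders(3)[OF g] by eventually_elim (simp add: P_def)
  have anP: "P analytic_on {0}" unfolding P_def
    by (intro analytic_intros anB local_param_analytic[OF g])
  have "eventually (\<lambda>t. G (-1) t / G 1 t - 1 = (-2 * \<i>) * (P t / G 1 t)) (at 0)"
    using numerators_eventually_nonzero(1)
  proof eventually_elim
    case (elim t)
    have "G (-1) t - G 1 t = - 2 * \<i> * P t" by (simp add: jost_numerator_def P_def)
    then have "(G (-1) t - G 1 t) / G 1 t = (-2 * \<i>) * (P t / G 1 t)" by simp
    then show ?case using elim by (simp add: diff_divide_distrib)
  qed
  then have "?l = zorder (\<lambda>t. (-2 * \<i>) * (P t / G 1 t)) 0" by (rule zorder_cong) simp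
  also have "\<dots> = zorder (\<lambda>t. P t / G 1 t) 0" by (rule zorder_cmult) simp
  also have "\<dots> = zorder P 0 - zorder (\<lambda>t. G 1 t) 0"
    using anP numerator_analytic Pnz numerators_eventually_nonzero(1)
    by (intro zorder_divide) (auto intro: analytic_on_imp_meromorphic_on eventually_frequently)
  also have "zorder P 0 = ramification z0 - 1 + int (order z0 B) * ramification z0"
    unfolding P_def using c(2) Pnz local_param_orders[OF g] anB local_param_analytic[OF g]
    by (subst zorder_times_analytic) (auto simp: P_def)
  finally show ?thesis .
qed

lemma zorder_scattering_at_zero_of_B:
  assumes "poly B z0 = 0"
  shows "zorder (\<lambda>t. G (-1) t / G 1 t - 1) 0
     = ramification z0 - 1 + (int (order z0 B) - (if poly Q z0 = 0 then 1 else 0)) * ramification z0"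
  unfolding zorder_scattering zorder_numerator_at_zero_of_B[OF assms] by (simp add: algebra_simps)

text \<open>
  At a branch point the factor \<open>w\<close> of \<open>S - 1\<close> has a zero; when \<open>Q\<close> vanishes too, so does the denominator,
  which compensates it.
\<close>
lemma zorder_scattering_nonpos:
  assumes "poly B z0 \<noteq> 0" "poly D z0 \<noteq> 0 \<or> poly Q z0 = 0"
  shows "zorder (\<lambda>t. G (-1) t / G 1 t - 1) 0 \<le> 0"
proof -
  have fr: "frequently (\<lambda>t. G 1 t \<noteq> 0) (at 0)"
    using numerators_eventually_nonzero by (intro eventually_frequently) auto
  have "zorder (\<lambda>t. G 1 t) 0 \<ge> ramification z0 - 1"
  proof (cases "poly D z0 = 0")
    case True
    then have "G 1 0 = 0"
      using assms(2) Q_D_common_root[of z0] curve_center[OF g]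
      by (simp add: jost_numerator_def half_trace_def local_param_center[OF g])
    then have "zorder (\<lambda>t. G 1 t) 0 > 0" using zorder_pos_iff'[OF numerator_analytic fr] by simp
    then show ?thesis using True by (simp add: ramification_def)
  next
    case False
    then show ?thesis using zorder_ge_0[OF numerator_analytic fr] by (simp add: ramification_def)
  qed
  then show ?thesis unfolding zorder_scattering using assms(1) by (simp add: order_0I)
qed

text \<open>
  The factor \<open>w\<close> makes \<open>S = 1\<close> at a band edge, unless \<open>f\<^sup>+\<close> vanishes there.
\<close>
lemma zorder_scattering_at_edge:
  assumes "poly D z0 = 0" "poly (half_trace A B) z0 \<noteq> 0"
  shows "zorder (\<lambda>t. G (-1) t / G 1 t - 1) 0 > 0"
proof -
  have "G 1 0 \<noteq> 0" using assms curve_center[OF g] by (simp add: jost_numerator_def local_param_center[OF g])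
  then have "zorder (\<lambda>t. G 1 t) 0 = 0" using numerator_analytic by (simp add: zorder_eq_0I)
  then show ?thesis unfolding zorder_scattering using assms by (simp add: ramification_def)
qed

end

text \<open>
  The multiplicity of \<open>x\<close> as a zero of \<open>S - 1\<close>, written with the numerators \<open>Q f\<^sup>\<plusminus>\<close>.
\<close>
definition scattering_order :: "complex poly \<Rightarrow> complex poly \<Rightarrow> complex \<times> complex \<Rightarrow> nat" where
  "scattering_order A B x = nat (zorder (\<lambda>t.
      jost_numerator (-1) A B ((SOME g. local_param curve x g) t) /
      jost_numerator 1 A B ((SOME g. local_param curve x g) t) - 1) 0)"

context
  fixes A B :: "complex poly" and z w :: complex
  assumes B_nonzero: "B \<noteq> 0"
    and simple: "\<And>z. poly (jost_product A B) z = 0 \<Longrightarrow> order z (jost_product A B) = 1"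
    and on_curve: "(z, w) \<in> curve"
begin

lemma some_local_param: "local_param curve (z, w) (SOME g. local_param curve (z, w) g)"
  using local_param_exists[OF on_curve] by (rule someI_ex)

lemma order_at_edge:
  assumes "poly D z = 0" "poly Q z \<noteq> 0" "scattering_order A B (z, w) = 0"
  shows "poly (half_trace A B) z = 0" "poly B z \<noteq> 0"
proof -
  show "poly (half_trace A B) z = 0"
    using zorder_scattering_at_edge[OF B_nonzero simple some_local_param] assms
    by (force simp: scattering_order_def)
  show "poly B z \<noteq> 0"
  proof
    assume "poly B z = 0"
    from zorder_scattering_at_zero_of_B[OF B_nonzero simple some_local_param this]
    have "scattering_order A B (z, w) = nat (1 + int (order z B) * 2)"
      unfolding scattering_order_def using assms by (simp add: ramification_def)
    then show False using assms(3) by simp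
  qed
qed

lemma order_at_dirichlet:
  assumes "poly D z \<noteq> 0" "poly Q z = 0" "scattering_order A B (z, w) = 0"
  shows "order z B \<le> 1"
proof (cases "poly B z = 0")
  case True
  from zorder_scattering_at_zero_of_B[OF B_nonzero simple some_local_param this]
  have "scattering_order A B (z, w) = nat (int (order z B) - 1)"
    unfolding scattering_order_def using assms by (simp add: ramification_def)
  then show ?thesis using assms(3) by simp
qed (simp add: order_0I)

text \<open>
  For a zero of order \<open>k \<ge> 1\<close> the scattering order is \<open>k\<close> when \<open>z\<close> is a zero of neither \<open>Q\<close> nor \<open>D\<close>, and
  \<open>2 k - 1\<close> when it is a zero of both; it is \<open>0\<close> for \<open>k = 0\<close>. The formula inverts both at once.
\<close>
lemma order_determined:
  assumes "poly D z = 0 \<longleftrightarrow> poly Q z = 0"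
  shows "order z B = (if poly D z = 0 then (scattering_order A B (z, w) + 1) div 2
     else scattering_order A B (z, w))"
proof (cases "poly B z = 0")
  case True
  then have pos: "order z B > 0" using B_nonzero order_root[of B z] by simp
  from zorder_scattering_at_zero_of_B[OF B_nonzero simple some_local_param True]
  have "scattering_order A B (z, w) = (if poly D z = 0 then 2 * order z B - 1 else order z B)"
    unfolding scattering_order_def using assms pos
    by (cases "poly D z = 0") (simp_all add: ramification_def nat_eq_iff of_nat_diff)
  then show ?thesis using pos by simp
next
  case False
  then have "scattering_order A B (z, w) = 0"
    using zorder_scattering_nonpos[OF B_nonzero simple some_local_param False] assms
    by (auto simp: scattering_order_def)
  then show ?thesis using False by (simp add: order_0I)
qed

end
end

section \<open>Real polynomials at complex points\<close>

abbreviation of_real_poly :: "real poly \<Rightarrow> complex poly" where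
  "of_real_poly \<equiv> map_poly complex_of_real"

lemma coeff_of_real_poly [simp]: "coeff (of_real_poly p) n = of_real (coeff p n)"
  by (simp add: coeff_map_poly)

lemma degree_of_real_poly [simp]: "degree (of_real_poly p) = degree p"
  by (rule degree_map_poly) simp

lemma of_real_poly_eq_0_iff [simp]: "of_real_poly p = 0 \<longleftrightarrow> p = 0"
  by (simp add: poly_eq_iff)

lemma of_real_poly_mult: "of_real_poly (p * r) = of_real_poly p * of_real_poly r"
  by (rule poly_eqI) (simp add: coeff_mult)

lemma of_real_poly_pderiv: "pderiv (of_real_poly p) = of_real_poly (pderiv p)"
  by (rule poly_eqI) (simp add: coeff_pderiv)

lemma poly_of_real_poly: "poly (of_real_poly p) z = cpoly p z"
  by (simp add: cpoly_def)

lemma cpoly_simps [simp]: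
  "cpoly (p + r) z = cpoly p z + cpoly r z"
  "cpoly (p - r) z = cpoly p z - cpoly r z"
  "cpoly (p * r) z = cpoly p z * cpoly r z"
  "cpoly (smult c p) z = of_real c * cpoly p z"
  "cpoly (pCons c p) z = of_real c + z * cpoly p z"
  "cpoly 0 z = 0" "cpoly 1 z = 1"
proof -
  have "of_real_poly (p + r) = of_real_poly p + of_real_poly r" "of_real_poly (p - r) = of_real_poly p - of_real_poly r" "of_real_poly (smult c p) = smult (of_real c) (of_real_poly p)"
    by (auto intro!: poly_eqI)
  then show "cpoly (p + r) z = cpoly p z + cpoly r z" "cpoly (p - r) z = cpoly p z - cpoly r z"
    "cpoly (smult c p) z = of_real c * cpoly p z"
    by (simp_all add: cpoly_def)
qed (simp_all add: cpoly_def of_real_poly_mult map_poly_pCons)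

lemma cpoly_power [simp]: "cpoly (p ^ n) z = cpoly p z ^ n"
  by (induction n) simp_all

lemma cpoly_numeral [simp]: "cpoly (numeral n) z = numeral n"
  by (simp add: numeral_poly)

lemma cpoly_of_real: "cpoly p (of_real x) = of_real (poly p x)"
  by (induction p) simp_all

section \<open>Real-rooted polynomials\<close>

lemma rsquarefree_of_real_poly:
  assumes "rsquarefree p" "\<And>z. cpoly p z = 0 \<Longrightarrow> Im z = 0"
  shows "rsquarefree (of_real_poly p)"
  unfolding rsquarefree_roots
proof (intro allI notI)
  fix z assume z: "poly (of_real_poly p) z = 0 \<and> poly (pderiv (of_real_poly p)) z = 0"
  then have "Im z = 0" using assms(2) by (simp add: cpoly_def)
  then have "z = of_real (Re z)" by (simp add: complex_eq_iff)
  then obtain x where "z = of_real x" by blast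
  then have "poly p x = 0 \<and> poly (pderiv p) x = 0"
    using z unfolding of_real_poly_pderiv poly_of_real_poly by (simp add: cpoly_of_real)
  then show False using assms(1) unfolding rsquarefree_roots by blast
qed

lemma real_rooted_decompose:
  assumes "\<And>z. cpoly p z = 0 \<Longrightarrow> Im z = 0" "p \<noteq> 0"
  shows "p = smult (lead_coeff p) (\<Prod>x\<in>#proots p. [:-x, 1:])"
  using assms
proof (induction "degree p" arbitrary: p)
  case 0
  then obtain c where "p = [:c:]" by (metis degree_eq_zeroE)
  then show ?case by simp
next
  case (Suc n)
  have "degree (of_real_poly p) \<noteq> 0" using Suc.hyps by simp
  then obtain z where z: "poly (of_real_poly p) z = 0" using fundamental_theorem_of_algebra constant_degree by metis
  then have "z = of_real (Re z)" using Suc.prems by (simp add: complex_eq_iff poly_of_real_poly)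
  then obtain x where "z = of_real x" by blast
  then have "poly p x = 0" using z unfolding poly_of_real_poly by (simp add: cpoly_of_real)
  then obtain r where r: "p = [:-x, 1:] * r" by (auto simp: poly_eq_0_iff_dvd elim: dvdE)
  then have r0: "r \<noteq> 0" using Suc.prems by auto
  have "degree p = Suc (degree r)" unfolding r using r0 by (subst degree_mult_eq) auto
  moreover have "Im z = 0" if "cpoly r z = 0" for z
    by (rule Suc.prems(1)) (unfold r cpoly_simps(3), simp add: that)
  ultimately have "r = smult (lead_coeff r) (\<Prod>x\<in>#proots r. [:-x, 1:])"
    using Suc.hyps r0 by auto
  moreover have "proots p = add_mset x (proots r)" unfolding r using r0 by (subst proots_mult) auto
  moreover have "lead_coeff p = lead_coeff r" unfolding r lead_coeff_mult by simp
  ultimately show ?case using r by (metis image_mset_add_mset mult_smult_right prod_mset.add_mset)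
qed

lemma size_proots_real_rooted:
  assumes "\<And>z. cpoly p z = 0 \<Longrightarrow> Im z = 0" "p \<noteq> 0"
  shows "size (proots p) = degree p"
proof -
  have "degree (\<Prod>x\<in>#S. [:-x, 1:]) = size S" for S :: "real multiset"
  proof (induction S)
    case (add x S)
    have "(\<Prod>x\<in>#S. [:-x, 1:]) \<noteq> 0" by (auto simp: prod_mset_zero_iff)
    then show ?case using add by (simp add: degree_mult_eq del: mult_pCons_left)
  qed simp
  then have "degree (smult (lead_coeff p) (\<Prod>x\<in>#proots p. [:-x, 1:])) = size (proots p)"
    using assms(2) by simp
  then show ?thesis using real_rooted_decompose[OF assms] by metis
qed

text \<open>
  The Laguerre inequality, \<open>(P' / P)' < 0\<close> in the form \<open>P'\<^sup>2 - P P'' > 0\<close>. Multiplication by \<open>x - r\<close> turns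
  \<open>P'\<^sup>2 - P P''\<close> into \<open>P\<^sup>2 + (x - r)\<^sup>2 (P'\<^sup>2 - P P'')\<close>, which settles it by induction.
\<close>
lemma laguerre_prod:
  fixes S :: "real multiset" and e :: real
  defines "P \<equiv> (\<Prod>x\<in>#S. [:-x, 1:])"
  assumes S: "S \<noteq> {#}" and nz: "poly P e \<noteq> 0"
  shows "(poly (pderiv P) e)\<^sup>2 - poly P e * poly (pderiv (pderiv P)) e > 0"
proof -
  define L where "L R = (poly (pderiv R) e)\<^sup>2 - poly R e * poly (pderiv (pderiv R)) e" for R :: "real poly"
  have step: "L ([:-x, 1:] * R) = (poly R e)\<^sup>2 + (e - x)\<^sup>2 * L R" for x R
    unfolding L_def by (simp add: pderiv_mult pderiv_add pderiv_pCons pderiv_diff pderiv_smult algebra_simps power2_eq_square)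
  have ge: "L (\<Prod>x\<in>#S. [:-x, 1:]) \<ge> 0" for S
  proof (induction S)
    case empty
    then show ?case by (simp add: L_def)
  next
    case (add x S)
    then show ?case using step[of x] by (simp del: mult_pCons_left)
  qed
  obtain x T where "S = add_mset x T" using S by (meson multiset_cases)
  then have "P = [:-x, 1:] * (\<Prod>x\<in>#T. [:-x, 1:])" unfolding P_def by simp
  then have "L P = (poly (\<Prod>x\<in>#T. [:-x, 1:]) e)\<^sup>2 + (e - x)\<^sup>2 * L (\<Prod>x\<in>#T. [:-x, 1:])"
    and "poly (\<Prod>x\<in>#T. [:-x, 1:]) e \<noteq> 0"
    using step nz by (simp_all del: mult_pCons_left)
  then have "L P > 0" using ge[of T] by (simp add: add_pos_nonneg)
  then show "(poly (pderiv P) e)\<^sup>2 - poly P e * poly (pderiv (pderiv P)) e > 0" unfolding L_def .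
qed

lemma laguerre_critical_point:
  assumes real: "\<And>z. cpoly p z = 0 \<Longrightarrow> Im z = 0" and deg: "degree p > 0"
    and e: "poly (pderiv p) e = 0" "poly p e \<noteq> 0"
  shows "poly p e * poly (pderiv (pderiv p)) e < 0"
proof -
  define P where "P = (\<Prod>x\<in>#proots p. [:-x, 1:])"
  define c where "c = lead_coeff p"
  have p0: "p \<noteq> 0" using deg by auto
  have p: "p = smult c P" using real_rooted_decompose[OF real p0] by (simp add: P_def c_def)
  have "proots p \<noteq> {#}" using size_proots_real_rooted[OF real p0] deg by auto
  moreover have c0: "c \<noteq> 0" using p0 by (simp add: c_def)
  moreover have "poly P e \<noteq> 0" "poly (pderiv P) e = 0"
    using e c0 unfolding p by (auto simp: pderiv_smult)
  ultimately have "poly P e * poly (pderiv (pderiv P)) e < 0"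
    using laguerre_prod[of "proots p" e] unfolding P_def by simp
  moreover have "poly p e * poly (pderiv (pderiv p)) e = c\<^sup>2 * (poly P e * poly (pderiv (pderiv P)) e)"
    by (subst (1 2) p) (simp add: pderiv_smult power2_eq_square)
  ultimately show ?thesis using \<open>c \<noteq> 0\<close> by (simp add: mult_pos_neg)
qed

section \<open>Solutions of Jacobi recurrences\<close>

text \<open>
  The recurrence at a complex spectral parameter, for sequences of values rather than polynomials: Bloch
  and Jost solutions are not polynomial in \<open>z\<close>.
\<close>
definition jacobi_rec :: "(nat \<Rightarrow> real) \<Rightarrow> (nat \<Rightarrow> real) \<Rightarrow> complex \<Rightarrow> (nat \<Rightarrow> complex) \<Rightarrow> bool" where
  "jacobi_rec a b z y \<longleftrightarrow> (\<forall>k\<ge>1. of_real (a (k - 1)) * y (k - 1) + of_real (a k) * y (k + 1)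
     + of_real (b k) * y k = z * y k)"

lemma jacobi_recD:
  "jacobi_rec a b z y \<Longrightarrow>
     of_real (a n) * y n + of_real (a (Suc n)) * y (Suc (Suc n)) + of_real (b (Suc n)) * y (Suc n) = z * y (Suc n)"
  unfolding jacobi_rec_def by (drule spec[of _ "Suc n"]) simp

lemma jacobi_recI:
  "(\<And>n. of_real (a n) * y n + of_real (a (Suc n)) * y (Suc (Suc n)) + of_real (b (Suc n)) * y (Suc n) = z * y (Suc n))
    \<Longrightarrow> jacobi_rec a b z y"
  unfolding jacobi_rec_def
proof (intro allI impI)
  fix k :: nat assume H: "\<And>n. of_real (a n) * y n + of_real (a (Suc n)) * y (Suc (Suc n)) + of_real (b (Suc n)) * y (Suc n) = z * y (Suc n)"
    and "1 \<le> k"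
  then obtain n where "k = Suc n" by (cases k) auto
  then show "of_real (a (k - 1)) * y (k - 1) + of_real (a k) * y (k + 1) + of_real (b k) * y k = z * y k"
    using H[of n] by simp
qed

lemma jacobi_sol_rec:
  assumes "\<And>n. a n > 0"
  shows "jacobi_rec a b z (\<lambda>n. cpoly (jacobi_sol a b c0 c1 n) z)"
proof (rule jacobi_recI)
  fix n
  have "complex_of_real (a (Suc n)) \<noteq> 0" using assms[of "Suc n"] by simp
  then show "of_real (a n) * cpoly (jacobi_sol a b c0 c1 n) z + of_real (a (Suc n)) * cpoly (jacobi_sol a b c0 c1 (Suc (Suc n))) z +
      of_real (b (Suc n)) * cpoly (jacobi_sol a b c0 c1 (Suc n)) z = z * cpoly (jacobi_sol a b c0 c1 (Suc n)) z"
    by (simp add: field_simps)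
qed

lemma jacobi_rec_linear:
  assumes "jacobi_rec a b z y" "jacobi_rec a b z y'"
  shows "jacobi_rec a b z (\<lambda>n. c * y n + d * y' n)"
proof (rule jacobi_recI)
  fix n
  show "of_real (a n) * (c * y n + d * y' n) + of_real (a (Suc n)) * (c * y (Suc (Suc n)) + d * y' (Suc (Suc n)))
     + of_real (b (Suc n)) * (c * y (Suc n) + d * y' (Suc n)) = z * (c * y (Suc n) + d * y' (Suc n))"
    using jacobi_recD[OF assms(1), of n] jacobi_recD[OF assms(2), of n] by algebra
qed

lemma wronskian_constant:
  assumes "jacobi_rec a b z y" "jacobi_rec a b z y'"
  shows "of_real (a n) * (y n * y' (Suc n) - y (Suc n) * y' n) = of_real (a 0) * (y 0 * y' 1 - y 1 * y' 0)"
proof (induction n)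
  case (Suc n)
  have "of_real (a (Suc n)) * (y (Suc n) * y' (Suc (Suc n)) - y (Suc (Suc n)) * y' (Suc n))
    = of_real (a n) * (y n * y' (Suc n) - y (Suc n) * y' n)"
    using jacobi_recD[OF assms(1), of n] jacobi_recD[OF assms(2), of n] by algebra
  then show ?case using Suc by simp
qed simp

text \<open>
  The imaginary part of the recurrence paired with \<open>y\<close>. If the boundary terms cancel, \<open>Im z = 0\<close> follows:
  this is the self-adjointness of the Jacobi operator on a finite interval.
\<close>
lemma green_identity:
  assumes "jacobi_rec a b z y"
  shows "a n * Im (cnj (y n) * y (Suc n)) = a 0 * Im (cnj (y 0) * y 1) + Im z * (\<Sum>k=1..n. (cmod (y k))\<^sup>2)"
proof (induction n)
  case (Suc n)
  have "Im (cnj (y (Suc n)) * (of_real (a n) * y n + of_real (a (Suc n)) * y (Suc (Suc n)) + of_real (b (Suc n)) * y (Suc n)))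
      = Im (cnj (y (Suc n)) * (z * y (Suc n)))"
    using jacobi_recD[OF assms, of n] by simp
  then have "a (Suc n) * Im (cnj (y (Suc n)) * y (Suc (Suc n)))
      = a n * Im (cnj (y n) * y (Suc n)) + Im z * (cmod (y (Suc n)))\<^sup>2"
    unfolding cmod_power2 by (simp add: algebra_simps power2_eq_square)
  then show ?case using Suc by (simp add: algebra_simps)
qed simp

lemma jacobi_rec_unique:
  assumes a: "\<And>n. a n > 0" and y: "jacobi_rec a b z y" "jacobi_rec a b z y'"
    and eq: "y N = y' N" "y (Suc N) = y' (Suc N)"
  shows "y = y'"
proof -
  have nz: "complex_of_real (a n) \<noteq> 0" for n using a[of n] by simp
  have "y 0 = y' 0 \<and> y 1 = y' 1" using eq
  proof (induction N)
    case (Suc N)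
    have "of_real (a N) * y N = of_real (a N) * y' N"
      using jacobi_recD[OF y(1), of N] jacobi_recD[OF y(2), of N] Suc.prems by (metis add_right_cancel)
    then show ?case using Suc nz by simp
  qed simp
  then have "y n = y' n \<and> y (Suc n) = y' (Suc n)" for n
  proof (induction n)
    case (Suc n)
    have "of_real (a (Suc n)) * y (Suc (Suc n)) = of_real (a (Suc n)) * y' (Suc (Suc n))"
      using jacobi_recD[OF y(1), of n] jacobi_recD[OF y(2), of n] Suc by (metis add_left_cancel add_right_cancel)
    then show ?case using Suc nz by simp
  qed simp
  then show ?thesis by blast
qed

lemma jacobi_rec_exists:
  assumes a: "\<And>n. a n > 0"
  shows "\<exists>y. jacobi_rec a b z y \<and> y N = \<alpha> \<and> y (Suc N) = \<beta>"
proof (induction N arbitrary: \<alpha> \<beta>)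
  case 0
  let ?y = "\<lambda>n. \<alpha> * cpoly (jacobi_sol a b 1 0 n) z + \<beta> * cpoly (jacobi_sol a b 0 1 n) z"
  have "jacobi_rec a b z ?y" by (intro jacobi_rec_linear jacobi_sol_rec a)
  moreover have "?y 0 = \<alpha>" "?y (Suc 0) = \<beta>" by simp_all
  ultimately show ?case by blast
next
  case (Suc N)
  have nz: "complex_of_real (a n) \<noteq> 0" for n using a[of n] by simp
  obtain y where y: "jacobi_rec a b z y" "y (Suc N) = \<alpha>"
    "y N = (z * \<alpha> - of_real (a (Suc N)) * \<beta> - of_real (b (Suc N)) * \<alpha>) / of_real (a N)"
    using Suc by blast
  have "of_real (a N) * y N = z * \<alpha> - of_real (a (Suc N)) * \<beta> - of_real (b (Suc N)) * \<alpha>"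
    unfolding y(3) using nz[of N] by simp
  then have "of_real (a (Suc N)) * y (Suc (Suc N)) = of_real (a (Suc N)) * \<beta>"
    using jacobi_recD[OF y(1), of N] unfolding y(2) by algebra
  then show ?case using y nz by auto
qed

lemma phi_sol_degree:
  "degree (phi_sol a b (Suc n)) \<le> n" "coeff (phi_sol a b (Suc n)) n = 1 / (\<Prod>k=1..n. a k)"
proof -
  have "degree (phi_sol a b (Suc n)) \<le> n \<and> coeff (phi_sol a b (Suc n)) n = 1 / (\<Prod>k=1..n. a k)"
  proof (induction n rule: less_induct)
    case (less n)
    show ?case
    proof (cases n)
      case 0
      then show ?thesis by (simp add: phi_sol_def)
    next
      case (Suc m)
      define y where "y = phi_sol a b"
      have rec: "y (Suc (Suc m)) = smult (1 / a (Suc m)) ([:- b (Suc m), 1:] * y (Suc m) - smult (a m) (y m))"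
        by (simp add: y_def phi_sol_def)
      have 1: "degree (y (Suc m)) \<le> m" "coeff (y (Suc m)) m = 1 / (\<Prod>k=1..m. a k)"
        using less[of m] Suc by (auto simp: y_def)
      have 2: "degree (y m) \<le> m" 
      proof (cases m)
        case 0
        then show ?thesis by (simp add: y_def phi_sol_def)
      next
        case (Suc k)
        then show ?thesis using less[of k] \<open>n = Suc m\<close> by (auto simp: y_def)
      qed
      have "degree ([:- b (Suc m), 1:] * y (Suc m)) \<le> Suc m"
        by (rule order.trans[OF degree_mult_le]) (use 1 in simp)
      then have "degree (y (Suc (Suc m))) \<le> Suc m"
        unfolding rec using 2 by (intro order.trans[OF degree_smult_le] degree_diff_le) (auto intro: order.trans[OF degree_smult_le])
      moreover have "coeff (y m) (Suc m) = 0" "coeff (y (Suc m)) (Suc m) = 0"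
        using 1 2 by (auto intro: coeff_eq_0)
      then have "coeff (y (Suc (Suc m))) (Suc m) = 1 / (\<Prod>k=1..Suc m. a k)"
        unfolding rec using 1 by (simp add: coeff_pCons)
      ultimately show ?thesis using Suc by (simp add: y_def)
    qed
  qed
  then show "degree (phi_sol a b (Suc n)) \<le> n" "coeff (phi_sol a b (Suc n)) n = 1 / (\<Prod>k=1..n. a k)" by blast+
qed

lemma theta_sol_degree: "degree (theta_sol a b (Suc n)) \<le> n - 1"
proof (induction n rule: less_induct)
  case (less n)
  show ?case
  proof (cases n)
    case 0
    then show ?thesis by (simp add: theta_sol_def)
  next
    case (Suc m)
    define y where "y = theta_sol a b"
    have rec: "y (Suc (Suc m)) = smult (1 / a (Suc m)) ([:- b (Suc m), 1:] * y (Suc m) - smult (a m) (y m))"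
      by (simp add: y_def theta_sol_def)
    show ?thesis
    proof (cases m)
      case 0
      then show ?thesis using Suc by (simp add: theta_sol_def)
    next
      case (Suc k)
      have "degree ([:- b (Suc m), 1:] * y (Suc m)) \<le> m"
        by (rule order.trans[OF degree_mult_le]) (use less[of m] \<open>n = Suc m\<close> Suc in \<open>simp add: y_def\<close>)
      moreover have "degree (smult (a m) (y m)) \<le> m"
        by (rule order.trans[OF degree_smult_le]) (use less[of k] \<open>n = Suc m\<close> Suc in \<open>simp add: y_def\<close>)
      ultimately have "degree ([:- b (Suc m), 1:] * y (Suc m) - smult (a m) (y m)) \<le> m"
        by (rule degree_diff_le)
      then have "degree (y (Suc (Suc m))) \<le> m"
        unfolding rec by (rule order.trans[OF degree_smult_le])
      then show ?thesis using \<open>n = Suc m\<close> by (simp add: y_def)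
    qed
  qed
qed

section \<open>Spectral polynomials of the periodic background\<close>

lemma prod_list_sign:
  fixes e :: real
  assumes "\<forall>x\<in>set xs. e < x"
  shows "(-1) ^ length xs * poly (\<Prod>x\<leftarrow>xs. [:-x, 1:]) e > 0"
  using assms
proof (induction xs)
  case (Cons x xs)
  have "(-1) ^ length (x # xs) * poly (\<Prod>x\<leftarrow>x # xs. [:-x, 1:]) e
    = (x - e) * ((-1) ^ length xs * poly (\<Prod>x\<leftarrow>xs. [:-x, 1:]) e)"
    by (simp add: algebra_simps)
  then show ?case using Cons by simp
qed simp

lemma prod_list_pos:
  fixes e :: real
  assumes "\<forall>x\<in>set xs. x < e"
  shows "poly (\<Prod>x\<leftarrow>xs. [:-x, 1:]) e > 0"
  using assms
proof (induction xs)
  case (Cons x xs)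
  have "poly (\<Prod>x\<leftarrow>x # xs. [:-x, 1:]) e = (e - x) * poly (\<Prod>x\<leftarrow>xs. [:-x, 1:]) e"
    by (simp add: algebra_simps)
  then show ?case using Cons by simp
qed simp

lemma cmod_multipliers_inverse:
  "(X::complex)\<^sup>2 + w\<^sup>2 = 1 \<Longrightarrow> cmod (X + \<i> * w) * cmod (X - \<i> * w) = 1"
proof -
  assume "X\<^sup>2 + w\<^sup>2 = 1"
  then have "(X + \<i> * w) * (X - \<i> * w) = 1" by (simp add: algebra_simps power2_eq_square)
  then show ?thesis by (metis norm_mult norm_one)
qed

locale periodic_background =
  fixes q :: nat and a b :: "nat \<Rightarrow> real"
  assumes periodic: "periodic_jacobi q a b"
begin

abbreviation "phi \<equiv> phi_sol a b"
abbreviation "theta \<equiv> theta_sol a b"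
abbreviation "Delta \<equiv> discriminant q a b"

definition edge_poly :: "real poly" where
  "edge_poly = Delta\<^sup>2 - 1"

lemma q2: "q \<ge> 2" and a_pos: "a n > 0" and a_q: "a q = a 0" and a_prod: "(\<Prod>j=1..q. a j) = 1"
  using periodic unfolding periodic_jacobi_def by (auto, metis add_0)

lemma a_nz: "complex_of_real (a n) \<noteq> 0"
  using a_pos[of n] by simp

lemma phi_rec: "jacobi_rec a b z (\<lambda>n. cpoly (phi n) z)"
  and theta_rec: "jacobi_rec a b z (\<lambda>n. cpoly (theta n) z)"
  unfolding phi_sol_def theta_sol_def by (intro jacobi_sol_rec a_pos)+

lemma init: "cpoly (phi 0) z = 0" "cpoly (phi (Suc 0)) z = 1" "cpoly (theta 0) z = 1" "cpoly (theta (Suc 0)) z = 0"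
  by (simp_all add: phi_sol_def theta_sol_def)

lemma monodromy_det:
  "cpoly (theta q) z * cpoly (phi (Suc q)) z - cpoly (theta (Suc q)) z * cpoly (phi q) z = 1"
  using wronskian_constant[OF theta_rec phi_rec, of q z] a_nz[of 0] by (simp add: a_q init)

lemma dirichlet_real:
  assumes "cpoly (phi q) z = 0" shows "Im z = 0"
proof -
  have "Im z * (\<Sum>k=1..q. (cmod (cpoly (phi k) z))\<^sup>2) = 0"
    using green_identity[OF phi_rec, of q z] assms by (simp add: init)
  moreover have "(\<Sum>k=1..q. (cmod (cpoly (phi k) z))\<^sup>2) \<ge> (cmod (cpoly (phi 1) z))\<^sup>2"
    using q2 by (intro member_le_sum) auto
  ultimately show ?thesis by (simp add: init)
qed

lemma quasi_periodic_real:
  assumes y: "jacobi_rec a b z y" "y q = \<rho> * y 0" "y (Suc q) = \<rho> * y 1" and \<rho>: "cmod \<rho> = 1"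
    and nz: "y 0 \<noteq> 0 \<or> y 1 \<noteq> 0"
  shows "Im z = 0"
proof (rule ccontr)
  assume Im: "Im z \<noteq> 0"
  have "cnj (y q) * y (Suc q) = (cnj \<rho> * \<rho>) * (cnj (y 0) * y 1)" unfolding y(2,3) by simp
  also have "cnj \<rho> * \<rho> = 1" using \<rho> complex_norm_square[of \<rho>] by (simp add: mult.commute)
  finally have "(\<Sum>k=1..q. (cmod (y k))\<^sup>2) = 0"
    using green_identity[OF y(1), of q] a_q Im by simp
  then have "\<forall>k\<in>{1..q}. (cmod (y k))\<^sup>2 = 0" by (subst (asm) sum_nonneg_eq_0_iff) auto
  then have "y 1 = 0" "y 2 = 0" using q2 by auto
  then have "y 0 = 0" using jacobi_recD[OF y(1), of 0] a_nz[of 0] by (simp add: numeral_2_eq_2)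
  then show False using nz \<open>y 1 = 0\<close> by simp
qed

text \<open>
  If \<open>\<Delta>(z) = t \<in> [-1, 1]\<close>, the monodromy matrix has an eigenvalue \<open>\<rho>\<close> of modulus one, and the boundary terms
  of its eigensolution cancel in Green's identity. The case \<open>\<phi>\<^sub>q(z) = 0\<close> is separate because the
  eigenvector \<open>(\<phi>\<^sub>q, \<rho> - \<theta>\<^sub>q)\<close> may then be zero.
\<close>
lemma discriminant_real:
  assumes D: "cpoly Delta z = of_real t" and t: "\<bar>t\<bar> \<le> 1"
  shows "Im z = 0"
proof (cases "cpoly (phi q) z = 0")
  case False
  define \<rho> where "\<rho> = Complex t (sqrt (1 - t\<^sup>2))"
  have t1: "t\<^sup>2 \<le> 1" using t by (simp add: abs_square_le_1)
  have \<rho>1: "cmod \<rho> = 1" using t1 by (simp add: \<rho>_def cmod_def)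
  have \<rho>2: "\<rho>\<^sup>2 - 2 * of_real t * \<rho> + 1 = 0"
    using t1 by (simp add: \<rho>_def complex_eq_iff power2_eq_square)
  have tr: "cpoly (phi (Suc q)) z + cpoly (theta q) z = 2 * of_real t"
    using D by (simp add: discriminant_def)
  define y where "y n = cpoly (phi q) z * cpoly (theta n) z + (\<rho> - cpoly (theta q) z) * cpoly (phi n) z" for n
  have "jacobi_rec a b z y" unfolding y_def by (intro jacobi_rec_linear phi_rec theta_rec)
  moreover have y01: "y 0 = cpoly (phi q) z" "y 1 = \<rho> - cpoly (theta q) z" by (simp_all add: y_def init)
  moreover have "y q = \<rho> * y 0" unfolding y01 by (simp add: y_def algebra_simps)
  moreover have "y (Suc q) = \<rho> * y 1"
    unfolding y01 using monodromy_det[of z] tr \<rho>2 unfolding y_def by algebra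
  ultimately show ?thesis using quasi_periodic_real[of z y \<rho>] \<rho>1 False by simp
qed (rule dirichlet_real)

lemma cpoly_edge_poly: "cpoly edge_poly z = (cpoly Delta z)\<^sup>2 - 1"
  by (simp add: edge_poly_def)

lemma edge_real: "cpoly edge_poly z = 0 \<Longrightarrow> Im z = 0"
proof -
  assume "cpoly edge_poly z = 0"
  then have "(cpoly Delta z)\<^sup>2 = 1" by (simp add: edge_poly_def)
  then have "cpoly Delta z = of_real 1 \<or> cpoly Delta z = of_real (-1)" by (simp add: power2_eq_1_iff)
  then show ?thesis using discriminant_real[of z 1] discriminant_real[of z "-1"] by auto
qed

text \<open>
  The Wronskian of \<open>\<phi>\<close> and its derivative in the spectral parameter; at a zero of \<open>\<phi>\<^sub>q\<close> it shows that the
  derivative of \<open>\<phi>\<^sub>q\<close> does not vanish.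
\<close>
lemma phi_derivative_wronskian:
  "a n * (poly (phi n) x * poly (pderiv (phi (Suc n))) x - poly (pderiv (phi n)) x * poly (phi (Suc n)) x)
    = (\<Sum>k=1..n. (poly (phi k) x)\<^sup>2)"
proof (induction n)
  case 0
  then show ?case by (simp add: phi_sol_def)
next
  case (Suc n)
  have r: "smult (a (Suc n)) (phi (Suc (Suc n))) = [:- b (Suc n), 1:] * phi (Suc n) - smult (a n) (phi n)"
    using a_pos[of "Suc n"] by (simp add: phi_sol_def)
  have 1: "a (Suc n) * poly (phi (Suc (Suc n))) x = (x - b (Suc n)) * poly (phi (Suc n)) x - a n * poly (phi n) x"
    using arg_cong[OF r, of "\<lambda>p. poly p x"] by (simp add: algebra_simps)
  have 2: "a (Suc n) * poly (pderiv (phi (Suc (Suc n)))) x = poly (phi (Suc n)) x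
      + (x - b (Suc n)) * poly (pderiv (phi (Suc n))) x - a n * poly (pderiv (phi n)) x"
    using arg_cong[OF r, of "\<lambda>p. poly (pderiv p) x"]
    by (simp add: algebra_simps pderiv_smult pderiv_diff pderiv_add pderiv_pCons)
  have "a (Suc n) * (poly (phi (Suc n)) x * poly (pderiv (phi (Suc (Suc n)))) x
       - poly (pderiv (phi (Suc n))) x * poly (phi (Suc (Suc n))) x)
     = poly (phi (Suc n)) x * (a (Suc n) * poly (pderiv (phi (Suc (Suc n)))) x)
       - poly (pderiv (phi (Suc n))) x * (a (Suc n) * poly (phi (Suc (Suc n))) x)"
    by (simp add: algebra_simps)
  also have "\<dots> = (poly (phi (Suc n)) x)\<^sup>2 + a n * (poly (phi n) x * poly (pderiv (phi (Suc n))) x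
       - poly (pderiv (phi n)) x * poly (phi (Suc n)) x)"
    unfolding 1 2 by (simp add: algebra_simps power2_eq_square)
  finally show ?case using Suc by simp
qed

lemma degree_phi: "degree (phi (Suc n)) = n" "lead_coeff (phi (Suc n)) > 0"
proof -
  have "coeff (phi (Suc n)) n > 0" using a_pos by (simp add: phi_sol_degree(2) prod_pos)
  then have "degree (phi (Suc n)) \<ge> n" by (intro le_degree) simp
  then show d: "degree (phi (Suc n)) = n" using phi_sol_degree(1)[of a b n] by simp
  show "lead_coeff (phi (Suc n)) > 0" unfolding d using \<open>coeff (phi (Suc n)) n > 0\<close> .
qed

lemma degree_phi_q: "degree (phi q) = q - 1" "phi q \<noteq> 0"
  using degree_phi[of "q - 1"] q2 by (auto simp del: leading_coeff_0_iff)

lemma phi_q_squarefree: "rsquarefree (phi q)"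
  unfolding rsquarefree_roots
proof (intro allI notI, elim conjE)
  fix x assume x: "poly (phi q) x = 0" "poly (pderiv (phi q)) x = 0"
  have "(\<Sum>k=1..q. (poly (phi k) x)\<^sup>2) = 0" using phi_derivative_wronskian[of q x] x by simp
  moreover have "(\<Sum>k=1..q. (poly (phi k) x)\<^sup>2) \<ge> (poly (phi 1) x)\<^sup>2"
    using q2 by (intro member_le_sum) auto
  ultimately show False by (simp add: phi_sol_def)
qed

lemma theta_q_degree: "degree (theta q) < q"
  using theta_sol_degree[of a b "q - 1"] q2 by (simp add: Suc_diff_Suc)

lemma degree_half_sum:
  assumes "degree P < q" shows "degree (smult (1/2) (phi (Suc q) + P)) = q"
    "lead_coeff (smult (1/2) (phi (Suc q) + P)) = 1 / 2"
proof -
  have c: "coeff (smult (1/2) (phi (Suc q) + P)) q = 1 / 2"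
    using assms phi_sol_degree(2)[of a b q] a_prod by (simp add: coeff_eq_0)
  have "degree (smult (1/2) (phi (Suc q) + P)) \<le> q"
    using assms degree_phi(1)[of q] by (simp add: degree_add_le)
  then show "degree (smult (1/2) (phi (Suc q) + P)) = q" using le_degree[of _ q] c
    by (metis antisym zero_neq_one divide_eq_0_iff zero_neq_numeral)
  then show "lead_coeff (smult (1/2) (phi (Suc q) + P)) = 1 / 2" using c by simp
qed

lemma degree_discriminant: "degree Delta = q" "lead_coeff Delta = 1 / 2"
  using degree_half_sum[OF theta_q_degree] by (simp_all add: discriminant_def)

lemma degree_phi_anti: "degree (phi_anti q a b) = q"
  using degree_half_sum(1)[of "- theta q"] theta_q_degree by (simp add: phi_anti_def)

lemma edge_poly_degree: "degree edge_poly = 2 * q" "lead_coeff edge_poly > 0"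
proof -
  have "Delta \<noteq> 0" using degree_discriminant(1) q2 by auto
  then have d: "degree (Delta\<^sup>2) = 2 * q" using degree_discriminant by (simp add: degree_power_eq)
  show e: "degree edge_poly = 2 * q" unfolding edge_poly_def
    using d q2 degree_add_eq_left[of "-1" "Delta\<^sup>2"] by simp
  have "coeff edge_poly (2 * q) = lead_coeff (Delta\<^sup>2)"
    unfolding edge_poly_def d using q2 by (simp add: coeff_1 d)
  also have "\<dots> > 0" using \<open>Delta \<noteq> 0\<close> by (simp add: lead_coeff_power)
  finally show "lead_coeff edge_poly > 0" unfolding e .
qed

lemma edge_list_facts:
  "length (edge_list q a b) = 2 * q" "mset (edge_list q a b) = proots edge_poly" "sorted (edge_list q a b)"
proof -
  have "edge_poly \<noteq> 0" using edge_poly_degree(2) by auto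
  then have "size (proots edge_poly) = 2 * q"
    using size_proots_real_rooted[OF edge_real] edge_poly_degree(1) by simp
  then show "length (edge_list q a b) = 2 * q" "mset (edge_list q a b) = proots edge_poly" "sorted (edge_list q a b)"
    by (simp_all add: edge_list_def edge_poly_def flip: size_mset)
qed

end

locale gapped_background = periodic_background +
  assumes gaps: "all_gaps_open q a b"
begin

text \<open>
  Neighbouring positions \<open>2 j - 1\<close>, \<open>2 j\<close> are the ends of a gap. At positions \<open>2 j\<close>, \<open>2 j + 1\<close> suppose that a
  band collapses to \<open>e\<close>. The zeros of \<open>\<Delta>\<^sup>2 - 1\<close> to the right of \<open>e\<close> are even in number, so its second
  derivative at \<open>e\<close> is positive. But \<open>e\<close> is a critical point of the real-rooted polynomial \<open>\<Delta>\<close>, where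
  \<open>\<Delta> \<Delta>'' < 0\<close> by Laguerre, and this makes the second derivative negative.
\<close>
lemma edge_list_adjacent:
  assumes i: "Suc i < 2 * q"
  shows "edge_list q a b ! i < edge_list q a b ! Suc i"
proof (rule ccontr)
  define L where "L = edge_list q a b"
  assume "\<not> edge_list q a b ! i < edge_list q a b ! Suc i"
  then have eq: "L ! i = L ! Suc i"
    using edge_list_facts i sorted_nth_mono[of L i "Suc i"] by (fastforce simp: L_def)
  have gap: "L ! k < L ! Suc k" if "odd k" "Suc k < 2 * q" for k
  proof -
    obtain m where m: "k = 2 * m + 1" using \<open>odd k\<close> by (elim oddE)
    then have "Suc m \<in> {1..q-1}" using that by auto
    then have "edge_minus q a b (Suc m) < edge_plus q a b (Suc m)" using gaps by (simp add: all_gaps_open_def)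
    moreover have "Suc m \<noteq> q" using m that by auto
    ultimately show ?thesis using m by (simp add: edge_minus_def edge_plus_def L_def)
  qed
  have ev: "even i" using gap[of i] eq i by auto
  define e where "e = L ! i"
  have len: "length L = 2 * q" and srt: "sorted L" using edge_list_facts by (simp_all add: L_def)
  have below: "\<forall>x\<in>set (take i L). x < e"
  proof
    fix x assume "x \<in> set (take i L)"
    then obtain k where k: "k < i" "x = L ! k" using i len by (auto simp: in_set_conv_nth)
    then have "L ! k \<le> L ! (i - 1)" using i len srt by (intro sorted_nth_mono) auto
    also have "L ! (i - 1) < L ! i" using gap[of "i - 1"] ev k i by (cases i) auto
    finally show "x < e" using k by (simp add: e_def)
  qed
  have above: "\<forall>x\<in>set (drop (i + 2) L). e < x"
  proof
    fix x assume "x \<in> set (drop (i + 2) L)"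
    then obtain k where "k < length (drop (i + 2) L)" "x = drop (i + 2) L ! k" by (metis in_set_conv_nth)
    then have k: "i + 2 + k < 2 * q" "x = L ! (i + 2 + k)" using len by auto
    have "e < L ! Suc (Suc i)" unfolding e_def eq using gap[of "Suc i"] ev k by auto
    also have "\<dots> \<le> L ! (i + 2 + k)" using k len srt by (intro sorted_nth_mono) auto
    finally show "e < x" using k by simp
  qed
  have "L = take i L @ L ! i # L ! Suc i # drop (Suc (Suc i)) L"
    using i len by (metis Cons_nth_drop_Suc Suc_lessD id_take_nth_drop)
  then have split: "L = take i L @ e # e # drop (i + 2) L" using eq by (simp add: e_def)
  define P where "P xs = (\<Prod>x\<leftarrow>xs. [:-x, 1:])" for xs :: "real list"
  define R where "R = P (take i L) * P (drop (i + 2) L)"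
  have "edge_poly \<noteq> 0" using edge_poly_degree(2) by auto
  then have "edge_poly = smult (lead_coeff edge_poly) (\<Prod>x\<in>#mset L. [:-x, 1:])"
    using real_rooted_decompose[OF edge_real] edge_list_facts(2) by (simp add: L_def)
  also have "(\<Prod>x\<in>#mset L. [:-x, 1:]) = P L" unfolding P_def by (metis mset_map prod_mset_prod_list)
  also have "P L = [:-e, 1:] * [:-e, 1:] * R"
    by (subst split) (simp add: P_def R_def algebra_simps del: mult_pCons_left mult_pCons_right)
  finally have E: "edge_poly = smult (lead_coeff edge_poly) ([:-e, 1:] * [:-e, 1:] * R)" .
  define c where "c = lead_coeff edge_poly"
  define X where "X = [:-e, 1:] * [:-e, 1:] * R"
  have X: "poly X e = 0" "poly (pderiv X) e = 0" "poly (pderiv (pderiv X)) e = 2 * poly R e"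
    unfolding X_def by (simp_all add: pderiv_mult pderiv_pCons pderiv_add pderiv_smult pderiv_diff algebra_simps)
  have Ec: "edge_poly = smult c X" using E by (simp add: c_def X_def)
  have "poly (P (drop (i + 2) L)) e > 0"
    using prod_list_sign[OF above] ev len by (simp add: P_def)
  then have "poly R e > 0" using prod_list_pos[OF below] by (simp add: R_def P_def)
  moreover have "c > 0" using edge_poly_degree(2) by (simp add: c_def)
  ultimately have pos: "poly (pderiv (pderiv edge_poly)) e > 0" and zero: "poly edge_poly e = 0" "poly (pderiv edge_poly) e = 0"
    unfolding Ec using X by (simp_all add: pderiv_smult)
  have d1: "pderiv edge_poly = 2 * (Delta * pderiv Delta)"
    unfolding edge_poly_def by (simp add: power2_eq_square pderiv_diff pderiv_mult algebra_simps)
  have sq: "(poly Delta e)\<^sup>2 = 1" using zero(1) by (simp add: edge_poly_def)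
  then have nz: "poly Delta e \<noteq> 0" by auto
  then have crit: "poly (pderiv Delta) e = 0" using zero(2) unfolding d1 by simp
  have "pderiv (pderiv edge_poly) = 2 * (pderiv Delta * pderiv Delta + Delta * pderiv (pderiv Delta))"
    unfolding d1 by (simp add: pderiv_mult algebra_simps)
  then have "poly (pderiv (pderiv edge_poly)) e = 2 * (poly Delta e * poly (pderiv (pderiv Delta)) e)"
    using crit by simp
  also have "\<dots> < 0"
    using laguerre_critical_point[of Delta e] discriminant_real[of _ 0] degree_discriminant(1) q2 crit nz by simp
  finally show False using pos by simp
qed

lemma edge_poly_squarefree: "rsquarefree edge_poly"
proof -
  define L where "L = edge_list q a b"
  have len: "length L = 2 * q" and srt: "sorted L" using edge_list_facts by (simp_all add: L_def)
  have "L ! i < L ! j" if "i < j" "j < 2 * q" for i j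
    using edge_list_adjacent[of i] sorted_nth_mono[OF srt, of "Suc i" j] that len by (simp add: L_def)
  then have "distinct L" unfolding distinct_conv_nth len by (metis linorder_neqE_nat order_less_irrefl)
  then have "count (proots edge_poly) x \<le> 1" for x
    using edge_list_facts(2) by (metis L_def distinct_count_atmost_1 le_numeral_extra(4) zero_le)
  moreover have nz: "edge_poly \<noteq> 0" using edge_poly_degree(2) by auto
  ultimately have "order x edge_poly \<le> 1" for x by (metis count_proots)
  then show ?thesis using nz unfolding rsquarefree_def by (simp add: le_Suc_eq)
qed

sublocale spectral_data "of_real_poly edge_poly" "of_real_poly (phi q)" "of_real_poly (phi_anti q a b)" "of_real_poly (theta (Suc q))"
proof
  show "(of_real_poly (phi_anti q a b))\<^sup>2 + of_real_poly (phi q) * of_real_poly (theta (Suc q)) = of_real_poly edge_poly"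
  proof -
    have "poly ((of_real_poly (phi_anti q a b))\<^sup>2 + of_real_poly (phi q) * of_real_poly (theta (Suc q))) z = poly (of_real_poly edge_poly) z" for z
      using monodromy_det[of z]
      by (simp add: poly_of_real_poly phi_anti_def cpoly_edge_poly discriminant_def power2_eq_square field_simps)
    then show ?thesis by (simp add: poly_eq_poly_eq_iff[symmetric] fun_eq_iff)
  qed
  show "rsquarefree (of_real_poly edge_poly)" by (rule rsquarefree_of_real_poly[OF edge_poly_squarefree edge_real])
  show "rsquarefree (of_real_poly (phi q))" by (rule rsquarefree_of_real_poly[OF phi_q_squarefree dirichlet_real])
  show "degree (of_real_poly (phi q)) < degree (of_real_poly (phi_anti q a b))" using degree_phi_q(1) degree_phi_anti q2 by simp
  show "2 * degree (of_real_poly (phi q)) < degree (of_real_poly edge_poly)" using degree_phi_q(1) edge_poly_degree(1) q2 by simp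
qed

lemma edge_iff: "poly edge_poly x = 0 \<longleftrightarrow> (\<exists>k\<in>{0..q}. x = edge_minus q a b k \<or> x = edge_plus q a b k)"
proof -
  define L where "L = edge_list q a b"
  have len: "length L = 2 * q" using edge_list_facts by (simp add: L_def)
  have nz: "edge_poly \<noteq> 0" using edge_poly_degree(2) by auto
  have "set L = {x. poly edge_poly x = 0}"
    using edge_list_facts(2) nz by (metis L_def set_count_proots set_mset_mset)
  then have "poly edge_poly x = 0 \<longleftrightarrow> (\<exists>i<2*q. x = L ! i)" using len by (auto simp: set_conv_nth)
  also have "\<dots> \<longleftrightarrow> (\<exists>k\<in>{0..q}. x = edge_minus q a b k \<or> x = edge_plus q a b k)"
  proof
    assume "\<exists>i<2*q. x = L ! i"
    then obtain i where i: "i < 2 * q" "x = L ! i" by blast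
    show "\<exists>k\<in>{0..q}. x = edge_minus q a b k \<or> x = edge_plus q a b k"
    proof (cases "even i")
      case True
      then obtain k where "i = 2 * k" by blast
      then show ?thesis using i by (intro bexI[of _ k]) (auto simp: edge_plus_def L_def)
    next
      case False
      then obtain k where "i = 2 * k + 1" by (elim oddE)
      then show ?thesis using i by (intro bexI[of _ "Suc k"]) (auto simp: edge_minus_def L_def)
    qed
  next
    assume "\<exists>k\<in>{0..q}. x = edge_minus q a b k \<or> x = edge_plus q a b k"
    then obtain k where k: "k \<le> q" "x = edge_minus q a b k \<or> x = edge_plus q a b k" by auto
    define i where "i = (if x = edge_minus q a b k then (if k = 0 then 0 else 2 * k - 1)
      else if k = q then 2 * q - 1 else 2 * k)"
    have "x = L ! i" using k(2) by (auto simp: i_def edge_minus_def edge_plus_def L_def)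
    moreover have "i < 2 * q" using k(1) q2 by (auto simp: i_def)
    ultimately show "\<exists>i<2*q. x = L ! i" by blast
  qed
  finally show ?thesis .
qed

lemma dirichlet_iff: "poly (phi q) x = 0 \<longleftrightarrow> (\<exists>j\<in>{1..q-1}. x = dirichlet_ev q a b j)"
proof -
  define L where "L = sorted_list_of_multiset (proots (phi q))"
  have "length L = q - 1"
    using size_proots_real_rooted[OF dirichlet_real degree_phi_q(2)] degree_phi_q(1)
    by (simp add: L_def flip: size_mset)
  moreover have "set L = {x. poly (phi q) x = 0}" using degree_phi_q(2) by (simp add: L_def)
  ultimately have "poly (phi q) x = 0 \<longleftrightarrow> (\<exists>i<q-1. x = L ! i)" by (auto simp: set_conv_nth)
  also have "\<dots> \<longleftrightarrow> (\<exists>j\<in>{1..q-1}. x = L ! (j - 1))"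
  proof
    assume "\<exists>i<q-1. x = L ! i"
    then obtain i where "i < q - 1" "x = L ! i" by blast
    then show "\<exists>j\<in>{1..q-1}. x = L ! (j - 1)" by (intro bexI[of _ "Suc i"]) auto
  next
    assume "\<exists>j\<in>{1..q-1}. x = L ! (j - 1)"
    then obtain j where "j \<in> {1..q-1}" "x = L ! (j - 1)" by blast
    then show "\<exists>i<q-1. x = L ! i" by (intro exI[of _ "j - 1"]) auto
  qed
  finally show ?thesis by (simp add: dirichlet_ev_def L_def)
qed

section \<open>Points of the first sheet\<close>

lemma surface_eq: "surface q a b = curve"
  by (auto simp: surface_def curve_def poly_of_real_poly cpoly_edge_poly)

lemma cpoly_edge_iff:
  "cpoly edge_poly z = 0 \<longleftrightarrow>
     (\<exists>k\<in>{0..q}. z = of_real (edge_minus q a b k) \<or> z = of_real (edge_plus q a b k))"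
proof
  assume z: "cpoly edge_poly z = 0"
  then have "z = of_real (Re z)" using edge_real by (simp add: complex_eq_iff)
  then obtain x where x: "z = of_real x" by blast
  then have "poly edge_poly x = 0" using z by (simp add: cpoly_of_real)
  then show "\<exists>k\<in>{0..q}. z = of_real (edge_minus q a b k) \<or> z = of_real (edge_plus q a b k)"
    unfolding edge_iff x by auto
next
  assume "\<exists>k\<in>{0..q}. z = of_real (edge_minus q a b k) \<or> z = of_real (edge_plus q a b k)"
  then obtain x where "z = of_real x" "poly edge_poly x = 0" unfolding edge_iff by blast
  then show "cpoly edge_poly z = 0" by (simp add: cpoly_of_real)
qed

lemma cpoly_phi_q_iff: "cpoly (phi q) z = 0 \<longleftrightarrow> (\<exists>j\<in>{1..q-1}. z = of_real (dirichlet_ev q a b j))"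
proof
  assume z: "cpoly (phi q) z = 0"
  then have "z = of_real (Re z)" using dirichlet_real by (simp add: complex_eq_iff)
  then obtain x where x: "z = of_real x" by blast
  then have "poly (phi q) x = 0" using z by (simp add: cpoly_of_real)
  then show "\<exists>j\<in>{1..q-1}. z = of_real (dirichlet_ev q a b j)" unfolding dirichlet_iff x by auto
next
  assume "\<exists>j\<in>{1..q-1}. z = of_real (dirichlet_ev q a b j)"
  then obtain x where "z = of_real x" "poly (phi q) x = 0" unfolding dirichlet_iff by blast
  then show "cpoly (phi q) z = 0" by (simp add: cpoly_of_real)
qed

lemma edge_points_iff: "x \<in> edge_points q a b \<longleftrightarrow> x \<in> closed_sheet1 q a b \<and> poly (of_real_poly edge_poly) (fst x) = 0"
  unfolding poly_of_real_poly cpoly_edge_iff edge_points_def by blast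

lemma dirichlet_points_iff: "x \<in> dirichlet_points q a b \<longleftrightarrow> x \<in> closed_sheet1 q a b \<and> poly (of_real_poly (phi q)) (fst x) = 0"
  unfolding poly_of_real_poly cpoly_phi_q_iff dirichlet_points_def by blast

text \<open>
  \<open>\<Delta> + i w\<close> and \<open>\<Delta> - i w\<close> are inverse to each other, so one of them has modulus at most one.
\<close>
lemma closed_sheet_point:
  obtains w where "(z, w) \<in> closed_sheet1 q a b"
proof -
  define X where "X = cpoly Delta z"
  define w where "w = csqrt (1 - X\<^sup>2)"
  have w: "w\<^sup>2 = 1 - X\<^sup>2" by (simp add: w_def)
  have "cmod (X + \<i> * w) * cmod (X - \<i> * w) = 1" using w by (intro cmod_multipliers_inverse) simp
  then have "cmod (X + \<i> * w) \<le> 1 \<or> cmod (X + \<i> * (-w)) \<le> 1"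
    by (metis diff_conv_add_uminus less_le_not_le linorder_not_le mult_minus_right less_1_mult)
  then show ?thesis
    using that[of w] that[of "-w"] w by (auto simp: closed_sheet1_def surface_def X_def)
qed

text \<open>
  If neither of the two inverse numbers \<open>\<Delta> \<plusminus> i w\<close> is inside the unit circle, both are on it, and their mean
  \<open>\<Delta>\<close> has modulus at most one.
\<close>
lemma open_sheet_point:
  assumes "cmod (cpoly Delta z) > 1"
  obtains w where "(z, w) \<in> open_sheet1 q a b"
proof -
  define X where "X = cpoly Delta z"
  define w where "w = csqrt (1 - X\<^sup>2)"
  have w: "w\<^sup>2 = 1 - X\<^sup>2" by (simp add: w_def)
  have p: "cmod (X + \<i> * w) * cmod (X - \<i> * w) = 1" using w by (intro cmod_multipliers_inverse) simp
  have "cmod (X + \<i> * w) < 1 \<or> cmod (X - \<i> * w) < 1"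
  proof (rule ccontr)
    assume H: "\<not> (cmod (X + \<i> * w) < 1 \<or> cmod (X - \<i> * w) < 1)"
    then have "cmod (X + \<i> * w) * 1 \<le> cmod (X + \<i> * w) * cmod (X - \<i> * w)"
       "1 * cmod (X - \<i> * w) \<le> cmod (X + \<i> * w) * cmod (X - \<i> * w)"
      by (intro mult_left_mono mult_right_mono; simp)+
    then have "cmod (X + \<i> * w) + cmod (X - \<i> * w) \<le> 2" using p by simp
    then have "cmod ((X + \<i> * w) + (X - \<i> * w)) \<le> 2" using norm_triangle_ineq order.trans by blast
    then have "cmod (2 * X) \<le> 2" by (simp add: algebra_simps)
    then show False using assms by (simp add: norm_mult X_def)
  qed
  then show ?thesis
    using that[of w] that[of "-w"] w by (auto simp: open_sheet1_def surface_def X_def)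
qed

end

section \<open>Jost functions of a perturbation\<close>

lemma coeff_mult_bound:
  fixes P R :: "'a::comm_semiring_0 poly"
  assumes "degree P \<le> m" "degree R \<le> n"
  shows "coeff (P * R) (m + n) = coeff P m * coeff R n"
proof -
  have "coeff (P * R) (m + n) = (\<Sum>i\<le>m + n. coeff P i * coeff R (m + n - i))" by (rule coeff_mult)
  also have "\<dots> = (\<Sum>i\<le>m + n. if i = m then coeff P m * coeff R n else 0)"
  proof (intro sum.cong refl)
    fix i assume "i \<in> {..m + n}"
    then show "coeff P i * coeff R (m + n - i) = (if i = m then coeff P m * coeff R n else 0)"
      using assms by (cases i m rule: linorder_cases) (auto simp: coeff_eq_0)
  qed
  finally show ?thesis by simp
qed

lemma perturb_simps:
  "p \<ge> 1 \<Longrightarrow> perturb p a u 0 = a 0" "p < n \<Longrightarrow> perturb p a u n = a n"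
  "p \<ge> 1 \<Longrightarrow> perturb p a u p = a p + u p"
  by (simp_all add: perturb_def)

locale perturbation = gapped_background +
  fixes p \<nu> :: nat and u v :: "nat \<Rightarrow> real"
  assumes p1: "p \<ge> 1" and nu: "\<nu> \<in> {2 * p - 1, 2 * p}" and pert: "(u, v) \<in> pert_class p a \<nu>"
begin

abbreviation "a' \<equiv> perturb p a u"
abbreviation "b' \<equiv> perturb p b v"
abbreviation "phi' \<equiv> phi_sol a' b'"

lemma a'_pos: "a' n > 0"
  using pert a_pos[of n] by (auto simp: pert_class_def perturb_def)

text \<open>
  If \<open>f\<close> solves the perturbed recurrence and continues a background solution \<open>y\<close> beyond \<open>p\<close>, its Wronskian
  with the perturbed \<open>\<phi>\<close> is constant and equals \<open>a\<^sub>0 f\<^sub>0\<close> at \<open>0\<close>. At \<open>p\<close> it can be written with \<open>y\<close> because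
  \<open>a\<^sub>p f\<^sub>p = a\<^sub>p\<^sup>0 y\<^sub>p\<close>. So this polynomial is \<open>f\<^sub>0\<close>.
\<close>
definition wronskian_with :: "(nat \<Rightarrow> real poly) \<Rightarrow> real poly" where
  "wronskian_with y = smult (1 / a 0) (smult (a p) (y p * phi' (Suc p)) - smult (a' p) (y (Suc p) * phi' p))"

definition jost_A :: "real poly" where "jost_A = wronskian_with theta"
definition jost_B :: "real poly" where "jost_B = wronskian_with phi"

lemma bloch_rec: "jacobi_rec a b (fst x) (\<lambda>n. bloch q a b s n x)"
  using jacobi_rec_linear[OF theta_rec phi_rec, of "fst x" 1 "weyl_m q a b s x"] by (simp add: bloch_def)

text \<open>
  The Jost solution exists and is unique because the recurrence can be solved backwards. Its value at \<open>0\<close>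
  is linear in the Bloch solution \<open>\<theta> + m \<phi>\<close> that it continues.
\<close>
lemma jost_eq:
  "jost q a b p u v s 0 x = cpoly jost_A (fst x) + weyl_m q a b s x * cpoly jost_B (fst x)"
proof -
  define z where "z = fst x"
  define \<psi> where "\<psi> n = bloch q a b s n x" for n
  have \<psi>: "jacobi_rec a b z \<psi>" using bloch_rec[of x s] unfolding \<psi>_def z_def .
  obtain y where y: "jacobi_rec a' b' z y" "y (Suc p) = \<psi> (Suc p)" "y (Suc (Suc p)) = \<psi> (Suc (Suc p))"
    using jacobi_rec_exists[of a', OF a'_pos] by blast
  have tail: "y (Suc p + k) = \<psi> (Suc p + k) \<and> y (Suc (Suc p + k)) = \<psi> (Suc (Suc p + k))" for k
  proof (induction k)
    case (Suc k)
    define n where "n = Suc p + k"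
    have n: "p < n" "p < Suc n" by (simp_all add: n_def)
    have IH: "y n = \<psi> n" "y (Suc n) = \<psi> (Suc n)" using Suc by (simp_all add: n_def)
    have "of_real (a n) * \<psi> n + of_real (a (Suc n)) * y (Suc (Suc n)) + of_real (b (Suc n)) * \<psi> (Suc n) = z * \<psi> (Suc n)"
      using jacobi_recD[OF y(1), of n] unfolding perturb_simps(2)[OF n(1)] perturb_simps(2)[OF n(2)] IH .
    then have "of_real (a (Suc n)) * y (Suc (Suc n)) = of_real (a (Suc n)) * \<psi> (Suc (Suc n))"
      using jacobi_recD[OF \<psi>, of n] by algebra
    then have "y (Suc (Suc n)) = \<psi> (Suc (Suc n))" using a_nz by simp
    then show ?case using Suc by (simp add: n_def)
  qed (use y in simp)
  have tail': "y k = \<psi> k" if "k \<ge> p + 1" for k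
    using tail[of "k - Suc p"] that by simp
  have "(THE y. jacobi_rec a' b' z y \<and> (\<forall>k\<ge>p+1. y k = \<psi> k)) = y"
  proof (rule the_equality)
    show "jacobi_rec a' b' z y \<and> (\<forall>k\<ge>p+1. y k = \<psi> k)" using y(1) tail' by blast
    fix f assume f: "jacobi_rec a' b' z f \<and> (\<forall>k\<ge>p+1. f k = \<psi> k)"
    then show "f = y" by (intro jacobi_rec_unique[OF a'_pos _ y(1), of _ "Suc p"]) (auto simp: y(2,3))
  qed
  then have j: "jost q a b p u v s 0 x = y 0"
    by (simp add: jost_def jacobi_rec_def z_def \<psi>_def)
  have "jacobi_rec a' b' z (\<lambda>n. cpoly (phi' n) z)" unfolding phi_sol_def by (rule jacobi_sol_rec[OF a'_pos])
  from wronskian_constant[OF y(1) this, of p]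
  have "of_real (a' p) * y p * cpoly (phi' (Suc p)) z - of_real (a' p) * \<psi> (Suc p) * cpoly (phi' p) z = of_real (a 0) * y 0"
    using p1 y(2) by (simp add: phi_sol_def perturb_simps algebra_simps)
  moreover have "of_real (a' p) * y p = of_real (a p) * \<psi> p"
  proof -
    have lt: "p < Suc p" by simp
    have "of_real (a' p) * y p + of_real (a (Suc p)) * \<psi> (Suc (Suc p)) + of_real (b (Suc p)) * \<psi> (Suc p) = z * \<psi> (Suc p)"
      using jacobi_recD[OF y(1), of p] unfolding perturb_simps(2)[OF lt] y(2,3) .
    then show ?thesis using jacobi_recD[OF \<psi>, of p] by algebra
  qed
  ultimately have "of_real (a p) * \<psi> p * cpoly (phi' (Suc p)) z - of_real (a' p) * \<psi> (Suc p) * cpoly (phi' p) z = of_real (a 0) * y 0"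
    by simp
  then have "y 0 = (of_real (a p) * \<psi> p * cpoly (phi' (Suc p)) z - of_real (a' p) * \<psi> (Suc p) * cpoly (phi' p) z) / of_real (a 0)"
    using a_nz[of 0] by simp
  also have "\<dots> = cpoly jost_A z + weyl_m q a b s x * cpoly jost_B z"
    using a_nz[of 0] by (simp add: jost_A_def jost_B_def wronskian_with_def \<psi>_def bloch_def z_def[symmetric] field_simps)
  finally show ?thesis unfolding j z_def .
qed

lemma degree_phi': "degree (phi' (Suc n)) \<le> n" "coeff (phi' (Suc n)) n = 1 / (\<Prod>k=1..n. a' k)"
  by (rule phi_sol_degree)+

lemma degree_jost_A: "degree jost_A \<le> \<nu> - 1"
proof -
  obtain m where m: "p = Suc m" using p1 by (cases p) auto
  have "degree (theta p * phi' (Suc p)) \<le> 2 * m"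
  proof (cases m)
    case 0
    then show ?thesis using m by (simp add: theta_sol_def)
  next
    case (Suc k)
    have "degree (theta p * phi' (Suc p)) \<le> (m - 1) + p"
      using theta_sol_degree[of a b m] degree_phi'(1)[of p] m by (intro order.trans[OF degree_mult_le] add_mono) auto
    then show ?thesis using m Suc by simp
  qed
  moreover have "degree (theta (Suc p) * phi' p) \<le> 2 * m"
    using theta_sol_degree[of a b p] degree_phi'(1)[of m] m by (intro order.trans[OF degree_mult_le]) auto
  ultimately have "degree (smult (a p) (theta p * phi' (Suc p)) - smult (a' p) (theta (Suc p) * phi' p)) \<le> 2 * m"
    by (intro degree_diff_le order.trans[OF degree_smult_le])
  then have "degree jost_A \<le> 2 * m" unfolding jost_A_def wronskian_with_def
    by (rule order.trans[OF degree_smult_le])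
  then show ?thesis using nu m by auto
qed

text \<open>
  The leading terms of the two products in the Wronskian nearly cancel. For \<open>u\<^sub>p \<noteq> 0\<close> the difference
  \<open>(a\<^sub>p\<^sup>0)\<^sup>2 - a\<^sub>p\<^sup>2\<close> survives. For \<open>u\<^sub>p = 0\<close> the top degree cancels completely, and one step of both
  recurrences exhibits the next coefficient, \<open>- v\<^sub>p\<close> times the product of leading coefficients.
\<close>
lemma jost_B_degree_coeff:
  "degree jost_B \<le> \<nu> - 1 \<and> coeff jost_B (\<nu> - 1) = - const_c2 p a \<nu> u v / (\<Prod>k=1..p. a k)"
proof -
  obtain m where m: "p = Suc m" using p1 by (cases p) auto
  define W where "W = smult (a p) (phi p * phi' (Suc p)) - smult (a' p) (phi (Suc p) * phi' p)"
  have B: "jost_B = smult (1 / a 0) W" by (simp add: jost_B_def wronskian_with_def W_def)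
  define \<alpha> where "\<alpha> = (\<Prod>k=1..m. a k)"
  define \<beta> where "\<beta> = (\<Prod>k=1..m. a' k)"
  have pos: "\<alpha> > 0" "\<beta> > 0" "a p > 0" "a' p > 0" "a 0 > 0"
    using a_pos a'_pos by (auto simp: \<alpha>_def \<beta>_def intro!: prod_pos)
  have prods: "(\<Prod>k=1..p. a k) = \<alpha> * a p" "(\<Prod>k=1..p. a' k) = \<beta> * a' p"
    by (simp_all add: m \<alpha>_def \<beta>_def)
  have "(\<Prod>j=0..p. a' j) = a' 0 * (\<Prod>k=1..p. a' k)"
    by (subst prod.atLeast_Suc_atMost) auto
  then have c1: "const_c1 p a u = 1 / (a 0 * (\<beta> * a' p))"
    unfolding const_c1_def prods using p1 by (simp add: perturb_simps)
  have d: "degree (phi p) \<le> m" "degree (phi (Suc p)) \<le> p" "degree (phi' p) \<le> m" "degree (phi' (Suc p)) \<le> p"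
    and c: "coeff (phi p) m = 1 / \<alpha>" "coeff (phi' p) m = 1 / \<beta>"
      "coeff (phi (Suc p)) p = 1 / (\<alpha> * a p)" "coeff (phi' (Suc p)) p = 1 / (\<beta> * a' p)"
    using phi_sol_degree[of a b m] phi_sol_degree[of a b p] degree_phi'[of m] degree_phi'[of p]
    unfolding m[symmetric] prods by (simp_all add: \<alpha>_def \<beta>_def)
  show ?thesis
  proof (cases "\<nu> = 2 * p")
    case True
    have "degree (phi p * phi' (Suc p)) \<le> m + p" "degree (phi (Suc p) * phi' p) \<le> m + p"
      using d by (auto intro!: order.trans[OF degree_mult_le])
    then have deg: "degree W \<le> m + p" unfolding W_def
      by (intro degree_diff_le order.trans[OF degree_smult_le])
    have "coeff W (m + p) = a p * (1 / \<alpha> * (1 / (\<beta> * a' p))) - a' p * (1 / (\<alpha> * a p) * (1 / \<beta>))"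
      using coeff_mult_bound[OF d(1) d(4)] coeff_mult_bound[OF d(2) d(3)] c
      by (simp add: W_def add.commute)
    also have "\<dots> = ((a p)\<^sup>2 - (a' p)\<^sup>2) / (\<alpha> * \<beta> * a p * a' p)"
      using pos by (simp add: field_simps power2_eq_square)
    also have "(a p)\<^sup>2 - (a' p)\<^sup>2 = - (u p * (a p + a' p))"
      using p1 by (simp add: perturb_simps power2_eq_square algebra_simps)
    finally have "coeff W (m + p) = - (u p * (a p + a' p)) / (\<alpha> * \<beta> * a p * a' p)" .
    then have "coeff jost_B (m + p) = - const_c2 p a \<nu> u v / (\<Prod>k=1..p. a k)"
      unfolding B prods using pos True by (simp add: const_c2_def c1 field_simps)
    moreover have "\<nu> - 1 = m + p" using True m by simp
    ultimately show ?thesis using deg unfolding B by (simp add: order.trans[OF degree_smult_le])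
  next
    case False
    then have nu': "\<nu> = 2 * p - 1" using nu by auto
    then have up: "u p = 0" using pert p1 by (auto simp: pert_class_def)
    then have ap: "a' p = a p" using p1 by (simp add: perturb_simps)
    have r: "smult (a p) (phi (Suc p)) = [:- b p, 1:] * phi p - smult (a m) (phi m)"
      using a_pos[of p] by (simp add: phi_sol_def m)
    have r': "smult (a p) (phi' (Suc p)) = [:- b' p, 1:] * phi' p - smult (a' m) (phi' m)"
      unfolding ap[symmetric] using a'_pos[of p] by (simp add: phi_sol_def m)
    define X where "X = [:- b p, 1:]"
    have bp: "[:- b' p, 1:] = X - [:v p:]" using p1 by (simp add: perturb_def X_def)
    have "W = phi p * smult (a p) (phi' (Suc p)) - smult (a p) (phi (Suc p)) * phi' p"
      by (simp add: W_def ap)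
    also have "\<dots> = smult (a m) (phi m * phi' p) - smult (a' m) (phi p * phi' m) - smult (v p) (phi p * phi' p)"
      unfolding r r' bp X_def[symmetric] by (simp add: algebra_simps)
    finally have W: "W = smult (a m) (phi m * phi' p) - smult (a' m) (phi p * phi' m) - smult (v p) (phi p * phi' p)" .
    have low: "degree (phi m) \<le> m" "coeff (phi m) m = 0" "degree (phi' m) \<le> m" "coeff (phi' m) m = 0"
    proof -
      have "degree (phi_sol c d m) \<le> m \<and> coeff (phi_sol c d m) m = 0" for c d
      proof (cases m)
        case (Suc k)
        then show ?thesis using phi_sol_degree(1)[of c d k] by (simp add: coeff_eq_0)
      qed (simp add: phi_sol_def)
      then show "degree (phi m) \<le> m" "coeff (phi m) m = 0" "degree (phi' m) \<le> m" "coeff (phi' m) m = 0" by auto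
    qed
    have deg: "degree W \<le> m + m" unfolding W
      by (intro degree_diff_le order.trans[OF degree_smult_le] order.trans[OF degree_mult_le] add_mono low d)
    have "coeff W (m + m) = - (v p / (\<alpha> * \<beta>))"
      unfolding W using coeff_mult_bound[OF low(1) d(3)] coeff_mult_bound[OF d(1) low(3)] coeff_mult_bound[OF d(1) d(3)]
      by (simp add: low c)
    then have "coeff jost_B (m + m) = - const_c2 p a \<nu> u v / (\<Prod>k=1..p. a k)"
      unfolding B prods using pos False by (simp add: const_c2_def c1 ap field_simps power2_eq_square)
    moreover have "\<nu> - 1 = m + m" using nu' m by simp
    ultimately show ?thesis using deg unfolding B by (simp add: order.trans[OF degree_smult_le])
  qed
qed

lemma const_c2_nonzero: "const_c2 p a \<nu> u v \<noteq> 0"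
proof -
  have "const_c1 p a u \<noteq> 0" using a'_pos by (simp add: const_c1_def prod_zero_iff less_imp_neq[symmetric])
  moreover have "a p \<noteq> 0" "a p + a' p \<noteq> 0" using a_pos[of p] a'_pos[of p] by auto
  moreover have "\<nu> = 2 * p \<longrightarrow> u p \<noteq> 0" "\<nu> \<noteq> 2 * p \<longrightarrow> v p \<noteq> 0" using pert p1 by (auto simp: pert_class_def)
  ultimately show ?thesis by (auto simp: const_c2_def)
qed

lemma degree_jost_B: "degree jost_B = \<nu> - 1"
  and lead_coeff_jost_B: "lead_coeff jost_B = - const_c2 p a \<nu> u v / (\<Prod>k=1..p. a k)"
  and jost_B_nonzero: "jost_B \<noteq> 0"
proof -
  have "(\<Prod>k=1..p. a k) > 0" using a_pos by (simp add: prod_pos)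
  then have "coeff jost_B (\<nu> - 1) \<noteq> 0"
    using jost_B_degree_coeff const_c2_nonzero by (metis divide_eq_0_iff less_irrefl neg_equal_0_iff_equal)
  then show d: "degree jost_B = \<nu> - 1" using jost_B_degree_coeff le_degree[of jost_B "\<nu> - 1"] by simp
  show "lead_coeff jost_B = - const_c2 p a \<nu> u v / (\<Prod>k=1..p. a k)" unfolding d using jost_B_degree_coeff by blast
  show "jost_B \<noteq> 0" using \<open>coeff jost_B (\<nu> - 1) \<noteq> 0\<close> by auto
qed

abbreviation "Ac \<equiv> of_real_poly jost_A"
abbreviation "Bc \<equiv> of_real_poly jost_B"

lemma jost_numerator_eq:
  assumes "cpoly (phi q) (fst x) \<noteq> 0"
  shows "jost_plus q a b p u v x = jost_numerator 1 Ac Bc x / cpoly (phi q) (fst x)"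
    and "jost_minus q a b p u v x = jost_numerator (-1) Ac Bc x / cpoly (phi q) (fst x)"
  using assms unfolding jost_plus_def jost_minus_def jost_eq jost_numerator_def half_trace_def weyl_m_def
  by (simp_all add: poly_of_real_poly field_simps)

text \<open>
  Uniqueness of the polynomial needs infinitely many points on the open sheet; they are supplied by
  large real \<open>z\<close>, where \<open>\<bar>\<Delta>\<bar> > 1\<close>.
\<close>
lemma F_poly_eq: "F_poly q a b p u v = jost_product Ac Bc"
proof -
  have prod: "cpoly (phi q) (fst x) * jost_plus q a b p u v x * jost_minus q a b p u v x = poly (jost_product Ac Bc) (fst x)"
    if x: "x \<in> surface q a b" "cpoly (phi q) (fst x) \<noteq> 0" for x
  proof -
    have "(snd x)\<^sup>2 = - poly (of_real_poly edge_poly) (fst x)" using x(1) unfolding surface_eq curve_def by auto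
    from numerator_product[OF this, of Ac Bc]
    have "jost_numerator 1 Ac Bc x * jost_numerator (-1) Ac Bc x = cpoly (phi q) (fst x) * poly (jost_product Ac Bc) (fst x)"
      by (simp add: poly_of_real_poly)
    then show ?thesis unfolding jost_numerator_eq[OF x(2)] using x(2) by (simp add: field_simps)
  qed
  have sub: "open_sheet1 q a b \<subseteq> surface q a b" by (auto simp: open_sheet1_def)
  show ?thesis unfolding F_poly_def
  proof (rule the_equality)
    show "\<forall>x\<in>open_sheet1 q a b. cpoly (phi q) (fst x) \<noteq> 0 \<longrightarrow>
        poly (jost_product Ac Bc) (fst x) = cpoly (phi q) (fst x) * jost_plus q a b p u v x * jost_minus q a b p u v x"
      using prod sub by (metis subsetD)
    fix F :: "complex poly"
    assume F: "\<forall>x\<in>open_sheet1 q a b. cpoly (phi q) (fst x) \<noteq> 0 \<longrightarrow>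
        poly F (fst x) = cpoly (phi q) (fst x) * jost_plus q a b p u v x * jost_minus q a b p u v x"
    have agree: "poly F z = poly (jost_product Ac Bc) z" if "cmod (cpoly Delta z) > 1" "cpoly (phi q) z \<noteq> 0" for z
    proof -
      obtain w where "(z, w) \<in> open_sheet1 q a b" using open_sheet_point[OF \<open>cmod (cpoly Delta z) > 1\<close>] .
      then show ?thesis using F prod[of "(z, w)"] sub that(2) by force
    qed
    obtain c D' where D': "of_real_poly Delta = pCons c D'" "D' \<noteq> 0"
      using degree_discriminant(1) q2 by (metis degree_of_real_poly degree_pCons_0 pCons_cases not_numeral_le_zero)
    obtain r where r: "\<And>z. r \<le> cmod z \<Longrightarrow> 2 \<le> cmod (poly (of_real_poly Delta) z)"
      using poly_infinity[OF D'(2), of 2 c] D'(1) by auto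
    have "infinite (of_real ` {max r 0..} :: complex set)"
      by (subst finite_image_iff) (auto simp: inj_on_def infinite_Ici)
    moreover have "of_real ` {max r 0..} \<subseteq> {z. poly ((F - jost_product Ac Bc) * of_real_poly (phi q)) z = 0}"
    proof clarify
      fix x :: real assume "x \<ge> max r 0"
      then have "1 < cmod (cpoly Delta (of_real x))" using r[of "of_real x"] by (simp add: poly_of_real_poly)
      then show "poly ((F - jost_product Ac Bc) * of_real_poly (phi q)) (of_real x) = 0"
        using agree[of "of_real x"] by (auto simp: poly_of_real_poly)
    qed
    ultimately have "infinite {z. poly ((F - jost_product Ac Bc) * of_real_poly (phi q)) z = 0}"
      using infinite_super by blast
    then have "(F - jost_product Ac Bc) * of_real_poly (phi q) = 0" using poly_roots_finite by blast
    then show "F = jost_product Ac Bc" using degree_phi_q(2) by simp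
  qed
qed

text \<open>
  \<open>S\<close> and the quotient of the numerators \<open>Q f\<^sup>\<plusminus>\<close> differ at most over the zeros of \<open>Q\<close>, where \<open>f\<^sup>\<plusminus>\<close> has no
  meaningful value. These points are isolated, and orders do not see them.
\<close>
lemma zeros_mult_eq:
  assumes "x \<in> closed_sheet1 q a b"
  shows "zeros_mult q a b p u v x = scattering_order Ac Bc x"
proof -
  have xc: "x \<in> curve" using assms unfolding surface_eq[symmetric] closed_sheet1_def by auto
  obtain z w where x: "x = (z, w)" by (cases x)
  define g where "g = (SOME g. local_param curve x g)"
  have g: "local_param curve (z, w) g" using local_param_exists xc unfolding g_def x by (metis someI_ex)
  have "of_real_poly (phi q) \<noteq> 0" using degree_phi_q(2) by simp
  from zorder_poly_compose(1)[OF local_param_analytic(1)[OF g] local_param_center(1)[OF g] local_param_orders(1)[OF g] this]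
  have "eventually (\<lambda>t. scattering q a b p u v (g t) - 1 =
      jost_numerator (-1) Ac Bc (g t) / jost_numerator 1 Ac Bc (g t) - 1) (at 0)"
    by eventually_elim (simp add: scattering_def poly_of_real_poly jost_numerator_eq)
  then have "zorder (\<lambda>t. scattering q a b p u v (g t) - 1) 0
     = zorder (\<lambda>t. jost_numerator (-1) Ac Bc (g t) / jost_numerator 1 Ac Bc (g t) - 1) 0"
    by (rule zorder_cong) simp
  then show ?thesis using assms
    by (simp add: zeros_mult_def order_at_def scattering_order_def surface_eq g_def)
qed

end

section \<open>Uniqueness of the Jost function\<close>

theorem theorem1p5:
  fixes q p \<nu> :: nat
    and a b u1 v1 u2 v2 :: "nat \<Rightarrow> real"
  assumes "periodic_jacobi q a b"
    and "p \<ge> 1"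
    and "all_gaps_open q a b"
    and "\<nu> \<in> {2 * p - 1, 2 * p}"
    and "(u1, v1) \<in> pert_class p a \<nu>"
    and "(u2, v2) \<in> pert_class p a \<nu>"
    and "(zeros_set q a b p u1 v1 - (dirichlet_points q a b \<inter> edge_points q a b)) \<inter>
           (dirichlet_points q a b \<union> edge_points q a b) = {}"
    and "\<forall>z. poly (F_poly q a b p u1 v1) z = 0 \<longrightarrow> order z (F_poly q a b p u1 v1) = 1"
    and "(zeros_set q a b p u2 v2 - (dirichlet_points q a b \<inter> edge_points q a b)) \<inter>
           (dirichlet_points q a b \<union> edge_points q a b) = {}"
    and "\<forall>z. poly (F_poly q a b p u2 v2) z = 0 \<longrightarrow> order z (F_poly q a b p u2 v2) = 1"
    and "F_poly q a b p u1 v1 = F_poly q a b p u2 v2"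
    and "zeros_mult q a b p u1 v1 = zeros_mult q a b p u2 v2"
    and "const_c2 p a \<nu> u1 v1 = const_c2 p a \<nu> u2 v2"
  shows "\<forall>x\<in>surface q a b. cpoly (phi_sol a b q) (fst x) \<noteq> 0 \<longrightarrow>
           jost_plus q a b p u1 v1 x = jost_plus q a b p u2 v2 x"
proof -
  interpret gapped_background q a b using assms by unfold_locales
  interpret P1: perturbation q a b p \<nu> u1 v1 using assms by unfold_locales
  interpret P2: perturbation q a b p \<nu> u2 v2 using assms by unfold_locales
  have simple1: "order z (jost_product P1.Ac P1.Bc) = 1" if "poly (jost_product P1.Ac P1.Bc) z = 0" for z
    using assms(8) that unfolding P1.F_poly_eq by blast
  have simple2: "order z (jost_product P2.Ac P2.Bc) = 1" if "poly (jost_product P2.Ac P2.Bc) z = 0" for z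
    using assms(10) that unfolding P2.F_poly_eq by blast
  have B_nonzero: "P1.Bc \<noteq> 0" "P2.Bc \<noteq> 0" using P1.jost_B_nonzero P2.jost_B_nonzero by simp_all
  have same_order: "scattering_order P1.Ac P1.Bc x = scattering_order P2.Ac P2.Bc x" if "x \<in> closed_sheet1 q a b" for x
    using P1.zeros_mult_eq[OF that] P2.zeros_mult_eq[OF that] assms(12) by simp
  have no_zero: "scattering_order P1.Ac P1.Bc (z, w) = 0 \<and> scattering_order P2.Ac P2.Bc (z, w) = 0"
    if "(z, w) \<in> closed_sheet1 q a b" "poly (of_real_poly edge_poly) z = 0 \<longleftrightarrow> poly (of_real_poly (phi q)) z \<noteq> 0" for z w
  proof -
    have "(z, w) \<in> edge_points q a b \<longleftrightarrow> (z, w) \<notin> dirichlet_points q a b"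
      using that by (simp add: edge_points_iff dirichlet_points_iff)
    then have "(z, w) \<notin> zeros_set q a b p u1 v1" "(z, w) \<notin> zeros_set q a b p u2 v2" using assms(7,9) by auto
    then show ?thesis
      using P1.zeros_mult_eq[OF that(1)] P2.zeros_mult_eq[OF that(1)] by (simp add: zeros_set_def)
  qed
  have curveI: "(z, w) \<in> curve" if "(z, w) \<in> closed_sheet1 q a b" for z w
    using that unfolding surface_eq[symmetric] closed_sheet1_def by auto
  have "P1.Ac = P2.Ac \<and> P1.Bc = P2.Bc"
  proof (rule components_unique)
    show "lead_coeff P1.Bc = lead_coeff P2.Bc"
      using P1.lead_coeff_jost_B P2.lead_coeff_jost_B assms(13) by simp
    show "degree P1.Ac \<le> degree P1.Bc" "degree P2.Ac \<le> degree P2.Bc"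
      using P1.degree_jost_A P2.degree_jost_A P1.degree_jost_B P2.degree_jost_B by simp_all
    show "jost_product P1.Ac P1.Bc = jost_product P2.Ac P2.Bc"
      using assms(11) unfolding P1.F_poly_eq P2.F_poly_eq .
    fix z
    obtain w where w: "(z, w) \<in> closed_sheet1 q a b" using closed_sheet_point .
    note c = curveI[OF w]
    show "poly (half_trace P1.Ac P1.Bc) z = 0 \<and> poly (half_trace P2.Ac P2.Bc) z = 0 \<and>
        poly P1.Bc z \<noteq> 0 \<and> poly P2.Bc z \<noteq> 0" if "poly (of_real_poly edge_poly) z = 0" "poly (of_real_poly (phi q)) z \<noteq> 0"
      using order_at_edge[OF B_nonzero(1) simple1 c] order_at_edge[OF B_nonzero(2) simple2 c] no_zero[OF w] that
      by simp
    show "order z P1.Bc \<le> 1 \<and> order z P2.Bc \<le> 1" if "poly (of_real_poly edge_poly) z \<noteq> 0" "poly (of_real_poly (phi q)) z = 0"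
      using order_at_dirichlet[OF B_nonzero(1) simple1 c] order_at_dirichlet[OF B_nonzero(2) simple2 c] no_zero[OF w] that
      by simp
    show "order z P1.Bc = order z P2.Bc" if "poly (of_real_poly edge_poly) z = 0 \<longleftrightarrow> poly (of_real_poly (phi q)) z = 0"
      using order_determined[OF B_nonzero(1) simple1 c that] order_determined[OF B_nonzero(2) simple2 c that]
        same_order[OF w] by simp
  qed (use B_nonzero in simp_all)
  then show ?thesis using P1.jost_numerator_eq(1) P2.jost_numerator_eq(1) by simp
qed

end
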